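(* Consider the stochastic first-order method described in the context where the proximal function is $\phi=\delta_{\{\mathbf z:\|\mathbf z\|_1\le\psi\}}$ (the indicator function of the $\ell_1$-ball of radius $\psi$) at every iteration, with minibatch gradient estimates $G^k=\frac1{m_k}\sum_{i=1}^{m_k}G(\mathbf x^k,\zeta_i^k)$, and suppose the standing assumptions in the context hold. Let $\epsilon>0$ and, for all $k$, $$\eta_k=\frac1L,\quad K=\left\lceil\frac{\Delta_fL}{\epsilon^2}\right\rceil,\quad m_k=m=\left\lceil\frac{e^2(\log d)\sigma_\infty^2}{\epsilon^2}\right\rceil,\quad \psi=\frac\epsilon L,\quad p_k=\frac1K.$$ Then $$\mathbb E\big[\mathrm{dist}_{\|\cdot\|_\infty}(0,\partial(f+\delta_X)(\mathbf x^{Y+1}))\big]\le C_1\epsilon,$$ where $C_1$ is an absolute constant. Therefore the sample complexity (total number of samples of $\zeta$ used) is $$Km=\mathcal O\left(\frac{\Delta_fL(\log d)\sigma_\infty^2}{\epsilon^4}\right),$$ where $\mathcal O$ hides an absolute constant and $\epsilon$ is small enough that $\Delta_fL/\epsilon^2\ge1$ and $e^2(\log d)\sigma_\infty^2/\epsilon^2\ge1$.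
   Context: Problem: minimize $f(\mathbf x)=\mathbb E[F(\mathbf x,\zeta)]$ over $\mathbf x\in X$, where $X\subseteq\mathbb R^d$ ($d\ge2$) is nonempty, closed and convex, $\zeta$ is a random vector with values in $\Xi$, $f:\mathbb R^d\to\mathbb R$ is well defined, finite and everywhere differentiable (possibly nonconvex). $\|\cdot\|$ is the Euclidean norm. There is a measurable $G:X\times\Xi\to\mathbb R^d$ (stochastic first-order oracle, which can be evaluated at any $(\mathbf x,\zeta)$) with $\mathbb E[G(\mathbf x,\zeta)]=\nabla f(\mathbf x)$ for all $\mathbf x\in X$. Standing assumptions: (i) $\sigma_\infty^2:=\max_{\mathbf x\in X}\mathbb E[\|G(\mathbf x,\zeta)-\nabla f(\mathbf x)\|_\infty^2]<\infty$; (ii) for a constant $L>0$, $\|\nabla f(\mathbf x)-\nabla f(\mathbf y)\|_\infty\le L\|\mathbf x-\mathbf y\|_1$ for all $\mathbf x,\mathbf y\in X$; (iii) $f(\mathbf x)\ge\underline f$ for all $\mathbf x\in X$, for some $\underline f\in\mathbb R$. Moreover $\Delta_f>0$ and $\sigma_\infty>0$, where $\Delta_f=\mathbb E[f(\mathbf x^1)]-\underline f$. Algorithm: choose $\mathbf x^1\in X$ and a positive integer $K$. For $k=1,\dots,K$: form a gradient estimate $G^k$ and set $$\mathbf x^{k+1}=\arg\min_{\mathbf x\in X}\left\{\tfrac12\|\mathbf x-(\mathbf x^k-\eta_kG^k)\|^2+\phi(\mathbf x-\mathbf x^k)\right\}.$$ Output $\mathbf x^{Y+1}$, where $Y$ is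 a random index, independent of everything else, with $\mathbb P[Y=k]=p_k$, $k=1,\dots,K$. In the minibatch estimate, the $\zeta_i^k$ are i.i.d. copies of $\zeta$, drawn afresh at each iteration (independent of the past). Notation: for a set $S$, $\delta_S$ is its indicator function ($0$ on $S$, $+\infty$ off $S$), $\partial$ is the Fréchet subdifferential, so for $\mathbf x\in X$, $\partial(f+\delta_X)(\mathbf x)=\nabla f(\mathbf x)+N_X(\mathbf x)$ with $N_X$ the normal cone, and $\mathrm{dist}_{\|\cdot\|_\infty}(0,S)=\inf\{\|\mathbf v\|_\infty:\mathbf v\in S\}$. *)

theory Defs
  imports "HOL-Probability.Probability"
begin

definition l1norm :: "real ^ 'n \<Rightarrow> real" where
  "l1norm x = (\<Sum>i\<in>UNIV. \<bar>x $ i\<bar>)"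

(* Meaningful only where f is differentiable. *)
definition grad :: "(real ^ 'n \<Rightarrow> real) \<Rightarrow> real ^ 'n \<Rightarrow> real ^ 'n" where
  "grad f x = (THE g. GDERIV f x :> g)"

(* Indicator in the sense of convex analysis, not the 0/1-valued indicator of the library. *)
definition set_indicator :: "'a set \<Rightarrow> 'a \<Rightarrow> ereal" where
  "set_indicator S x = (if x \<in> S then 0 else \<infinity>)"

definition frechet_subdiff :: "(real ^ 'n \<Rightarrow> ereal) \<Rightarrow> real ^ 'n \<Rightarrow> (real ^ 'n) set" where
  "frechet_subdiff h x =
     (if \<bar>h x\<bar> = \<infinity> then {}
      else {v. 0 \<le> Liminf (at x) (\<lambda>y. (h y - h x - ereal (v \<bullet> (y - x))) / ereal (norm (y - x)))})"

(* Distance from 0 to S in the infinity norm; ennreal-valued so that it is infinite for S = {}. *)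
definition dist0_inf :: "(real ^ 'n) set \<Rightarrow> ennreal" where
  "dist0_inf S = (INF v\<in>S. ennreal (infnorm v))"

(* Names for the independent sources of randomness: the initial point, the i-th sample drawn
   in iteration k, and the output index. *)
datatype source = Init | Sample nat nat | Index

(* Absolute constants. In a statement whose dimension d is the cardinality of an index type 'n,
   an existentially quantified constant could depend on 'n (and on the types of outcomes and
   samples); a closed monomorphic constant cannot. *)
definition C1 :: real where "C1 = 10"

(* The factor 4 comes from rounding up both K and m, the factor exp 1 ^ 2 from m. *)
definition C2 :: real where "C2 = 4 * exp 1 ^ 2"

end

(* Optimality of the step x -> y = x + z, with multiplier v of the l1-ball constraint, reads
   x - g / L - y - v in N_X(y), where N_X(y) is the normal cone; such a v exists because x lies in
   X and in the interior of the ball. Hence grad f(y) + L (x - g / L - y - v) is an element of the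
   subdifferential at y, of infinity norm at most 2 epsilon + delta + L |v|, where
   delta = |g - grad f(x)| in the infinity norm. Since v is normal to the ball, <v, z> = psi |v|,
   and the descent lemma gives L |v| <= (L / epsilon) (f(x) - f(y)) + delta + epsilon / 2. This
   telescopes along the iterates.

   The logarithmic dimension dependence comes from the potential
   smax s = ln (sum_i (exp s_i + exp (- s_i))): it dominates the infinity norm, is ln (2 d) at 0,
   and by Hoeffding's lemma smax (s + w) <= smax s + <q, w> + |w|^2 / 2 with q depending only on s.
   Adding the centred samples one at a time makes the linear terms vanish in expectation; with the
   scaling beta = epsilon / sigma^2 this gives E delta <= epsilon. *)
theory Submission
  imports Defs
begin

lemma inner_le_infnorm_l1norm:
  fixes x y :: "real ^ 'n"
  shows "x \<bullet> y \<le> infnorm x * l1norm y"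
proof -
  have "x \<bullet> y = (\<Sum>i\<in>UNIV. x $ i * y $ i)"
    by (simp add: inner_vec_def)
  also have "\<dots> \<le> (\<Sum>i\<in>UNIV. infnorm x * \<bar>y $ i\<bar>)"
  proof (rule sum_mono)
    fix i
    have "x $ i * y $ i \<le> \<bar>x $ i\<bar> * \<bar>y $ i\<bar>"
      by (metis abs_ge_self abs_mult)
    also have "\<dots> \<le> infnorm x * \<bar>y $ i\<bar>"
      by (intro mult_right_mono component_le_infnorm_cart) auto
    finally show "x $ i * y $ i \<le> infnorm x * \<bar>y $ i\<bar>" .
  qed
  finally show ?thesis
    by (simp add: l1norm_def sum_distrib_left)
qed

lemma infnorm_eq_component:
  fixes x :: "real ^ 'n"
  obtains i where "infnorm x = \<bar>x $ i\<bar>"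
proof -
  have "infnorm x = Max ((\<lambda>i. \<bar>x \<bullet> i\<bar>) ` Basis)"
    by (rule infnorm_Max)
  also have "\<dots> \<in> (\<lambda>i. \<bar>x \<bullet> i\<bar>) ` Basis"
    by (intro Max_in) auto
  finally show ?thesis
    using that by (auto simp: Basis_vec_def inner_axis)
qed

lemma l1norm_triangle: "l1norm (x + y) \<le> l1norm x + l1norm y"
  unfolding l1norm_def vector_add_component sum.distrib[symmetric]
  by (intro sum_mono abs_triangle_ineq)

lemma l1norm_scaleR: "l1norm (c *\<^sub>R x) = \<bar>c\<bar> * l1norm x"
  by (simp add: l1norm_def abs_mult sum_distrib_left)

lemma l1norm_minus_commute: "l1norm (x - y) = l1norm (y - x)"
  by (simp add: l1norm_def abs_minus_commute)

lemma l1norm_0 [simp]: "l1norm 0 = 0"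
  by (simp add: l1norm_def)

lemma l1norm_nonneg [simp]: "0 \<le> l1norm x"
  by (simp add: l1norm_def sum_nonneg)

lemma norm_le_l1norm: "norm x \<le> l1norm x"
  unfolding l1norm_def by (rule norm_le_l1_cart)

lemma infnorm_le_l1norm: "infnorm x \<le> l1norm x"
  using infnorm_le_norm norm_le_l1norm by (rule order_trans)

lemma continuous_on_l1norm [continuous_intros]:
  "continuous_on S h \<Longrightarrow> continuous_on S (\<lambda>x. l1norm (h x))"
  unfolding l1norm_def by (intro continuous_intros)

lemma infnorm_borel_measurable [measurable]: "infnorm \<in> borel_measurable borel"
  by (intro borel_measurable_continuous_onI continuous_intros)

lemma closed_l1ball: "closed {y. l1norm (y - x) \<le> \<psi>}"
  by (intro closed_Collect_le continuous_intros)

lemma convex_l1ball: "convex {y. l1norm (y - x) \<le> \<psi>}"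
proof (rule convexI)
  fix y z and u v :: real
  assume y: "y \<in> {y. l1norm (y - x) \<le> \<psi>}" and z: "z \<in> {y. l1norm (y - x) \<le> \<psi>}"
    and uv: "0 \<le> u" "0 \<le> v" "u + v = 1"
  have "u *\<^sub>R y + v *\<^sub>R z - x = u *\<^sub>R (y - x) + v *\<^sub>R (z - x)"
    using uv(3) by (simp add: algebra_simps flip: scaleR_left.add)
  then have "l1norm (u *\<^sub>R y + v *\<^sub>R z - x) \<le> u * l1norm (y - x) + v * l1norm (z - x)"
    using l1norm_triangle[of "u *\<^sub>R (y - x)" "v *\<^sub>R (z - x)"] uv by (simp add: l1norm_scaleR)
  also have "\<dots> \<le> \<psi>"
    using y z uv by (intro convex_bound_le) auto
  finally show "u *\<^sub>R y + v *\<^sub>R z \<in> {y. l1norm (y - x) \<le> \<psi>}" by simp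
qed

lemma ln_sum_exp_add_le:
  fixes s w :: "'i::finite \<Rightarrow> real"
  assumes w: "\<And>i. \<bar>w i\<bar> \<le> a"
  shows "ln (\<Sum>i\<in>UNIV. exp (s i + w i)) \<le>
    ln (\<Sum>i\<in>UNIV. exp (s i)) + (\<Sum>i\<in>UNIV. exp (s i) / (\<Sum>j\<in>UNIV. exp (s j)) * w i) + a\<^sup>2 / 2"
proof -
  define T where "T = (\<Sum>i\<in>UNIV. exp (s i))"
  define q where "q i = exp (s i) / T" for i
  define \<mu> where "\<mu> = (\<Sum>i\<in>UNIV. q i * w i)"
  have T: "T > 0" unfolding T_def by (intro sum_pos) auto
  have q: "q i \<ge> 0" for i using T by (simp add: q_def)
  have q1: "(\<Sum>i\<in>UNIV. q i) = 1"
    using T by (simp add: q_def sum_divide_distrib[symmetric] T_def[symmetric])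
  define P where "P = embed_pmf q"
  have pmfP: "pmf P i = q i" for i
    unfolding P_def using q q1
    by (intro pmf_embed_pmf) (auto simp: nn_integral_count_space_finite sum_ennreal)
  have E: "measure_pmf.expectation P h = (\<Sum>i\<in>UNIV. q i * h i)" for h :: "'i \<Rightarrow> real"
    by (subst integral_measure_pmf_real[of UNIV]) (auto simp: pmfP mult.commute)
  interpret H: interval_bounded_random_variable P w "-a" a
    using w by unfold_locales (auto simp: abs_le_iff intro!: AE_pmfI, smt)
  have "nn_integral P (\<lambda>x. exp (1 * (w x - \<mu>))) \<le> ennreal (exp (1\<^sup>2 * (a - (-a))\<^sup>2 / 8))"
    using H.Hoeffdings_lemma_nn_integral[of 1] by (simp add: E \<mu>_def)
  also have "nn_integral P (\<lambda>x. exp (1 * (w x - \<mu>))) = ennreal (\<Sum>i\<in>UNIV. q i * exp (w i - \<mu>))"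
    by (subst nn_integral_eq_integral) (auto simp: E intro!: integrable_measure_pmf_finite)
  finally have "(\<Sum>i\<in>UNIV. q i * exp (w i - \<mu>)) \<le> exp (a\<^sup>2 / 2)"
    by (simp add: power2_eq_square)
  also have "(\<Sum>i\<in>UNIV. q i * exp (w i - \<mu>)) = (\<Sum>i\<in>UNIV. exp (s i + w i)) / (T * exp \<mu>)"
    by (simp add: q_def exp_diff exp_add sum_divide_distrib)
  finally have "(\<Sum>i\<in>UNIV. exp (s i + w i)) \<le> T * exp \<mu> * exp (a\<^sup>2 / 2)"
    using T by (simp add: field_simps)
  then have "ln (\<Sum>i\<in>UNIV. exp (s i + w i)) \<le> ln (T * exp \<mu> * exp (a\<^sup>2 / 2))"
    using T by (subst ln_le_cancel_iff) (auto intro!: sum_pos)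
  also have "\<dots> = ln T + \<mu> + a\<^sup>2 / 2"
    using T by (simp add: ln_mult)
  finally show ?thesis
    by (simp add: T_def \<mu>_def q_def)
qed

definition signed_component :: "real ^ 'n \<Rightarrow> 'n \<times> bool \<Rightarrow> real" where
  "signed_component s = (\<lambda>(i, b). if b then s $ i else - s $ i)"

definition smax :: "real ^ 'n \<Rightarrow> real" where
  "smax s = ln (\<Sum>p\<in>UNIV. exp (signed_component s p))"

lemma smax_0: "smax (0 :: real ^ 'n) = ln (2 * real CARD('n))"
proof -
  have "signed_component (0 :: real ^ 'n) p = 0" for p
    by (simp add: signed_component_def case_prod_unfold)
  then show ?thesis by (simp add: smax_def mult.commute)
qed

lemma infnorm_le_smax: "infnorm s \<le> smax s"
proof -
  obtain i where "infnorm s = \<bar>s $ i\<bar>" by (rule infnorm_eq_component)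
  then obtain p where p: "infnorm s = signed_component s p"
    by (cases "0 \<le> s $ i") (auto simp: signed_component_def case_prod_unfold intro: that[of "(i, True)"] that[of "(i, False)"])
  have "exp (infnorm s) \<le> (\<Sum>p\<in>UNIV. exp (signed_component s p))"
    unfolding p by (rule member_le_sum) auto
  then show ?thesis
    unfolding smax_def by (subst ln_ge_iff) (auto intro!: sum_pos)
qed

lemma smax_nonneg: "0 \<le> smax s"
  using infnorm_pos_le infnorm_le_smax by (rule order_trans)

lemma smax_borel_measurable [measurable]: "smax \<in> borel_measurable (borel :: (real ^ 'n) measure)"
proof -
  have "continuous_on UNIV (\<lambda>s :: real ^ 'n. ln (\<Sum>p\<in>UNIV. exp (signed_component s p)))"
  proof (intro continuous_intros ballI)
    show "continuous_on UNIV (\<lambda>s. signed_component s p)" for p :: "'n \<times> bool"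
      by (cases p; cases "snd p") (auto simp: signed_component_def intro!: continuous_intros)
    fix s :: "real ^ 'n"
    have "(\<Sum>p\<in>UNIV. exp (signed_component s p)) > 0" by (intro sum_pos) auto
    then show "(\<Sum>p\<in>UNIV. exp (signed_component s p)) \<noteq> 0" by simp
  qed
  then show ?thesis
    unfolding smax_def by (intro borel_measurable_continuous_onI)
qed

lemma smax_smooth:
  fixes s :: "real ^ 'n"
  obtains q where "\<And>w. smax (s + w) \<le> smax s + q \<bullet> w + (infnorm w)\<^sup>2 / 2"
proof -
  define c where "c p = exp (signed_component s p) / (\<Sum>p\<in>UNIV. exp (signed_component s p))" for p
  define q :: "real ^ 'n" where "q = (\<chi> i. c (i, True) - c (i, False))"
  have "smax (s + w) \<le> smax s + q \<bullet> w + (infnorm w)\<^sup>2 / 2" for w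
  proof -
    have add: "signed_component (s + w) p = signed_component s p + signed_component w p" for p
      by (simp add: signed_component_def case_prod_unfold)
    have "\<bar>signed_component w p\<bar> \<le> infnorm w" for p
      using component_le_infnorm_cart[of w "fst p"] by (simp add: signed_component_def case_prod_unfold)
    then have "smax (s + w) \<le> smax s + (\<Sum>p\<in>UNIV. c p * signed_component w p) + (infnorm w)\<^sup>2 / 2"
      unfolding smax_def add c_def by (rule ln_sum_exp_add_le)
    also have "(\<Sum>p\<in>UNIV. c p * signed_component w p) = (\<Sum>i\<in>UNIV. \<Sum>b\<in>UNIV. c (i, b) * signed_component w (i, b))"
      unfolding sum.cartesian_product UNIV_Times_UNIV by (simp add: case_prod_unfold)
    also have "\<dots> = q \<bullet> w"
      by (simp add: UNIV_bool signed_component_def q_def inner_vec_def algebra_simps)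
    finally show ?thesis .
  qed
  then show ?thesis by (rule that)
qed

lemma GDERIV_grad:
  fixes f :: "real ^ 'n \<Rightarrow> real"
  assumes "f differentiable (at y)"
  shows "GDERIV f y :> grad f y"
proof -
  obtain f' where f': "(f has_derivative f') (at y)"
    using assms by (auto simp: differentiable_def)
  then interpret f': bounded_linear f' by (rule has_derivative_bounded_linear)
  have "f' h = h \<bullet> (\<Sum>b\<in>Basis. f' b *\<^sub>R b)" for h
  proof -
    have "f' h = f' (\<Sum>b\<in>Basis. (h \<bullet> b) *\<^sub>R b)" by (simp only: euclidean_representation)
    also have "\<dots> = (\<Sum>b\<in>Basis. (h \<bullet> b) * f' b)" by (simp only: f'.sum f'.scaleR real_scaleR_def)
    finally show ?thesis by (simp only: inner_sum_right inner_scaleR_right mult.commute)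
  qed
  then have "f' = (\<lambda>h. h \<bullet> (\<Sum>b\<in>Basis. f' b *\<^sub>R b))" by (rule ext)
  with f' have g: "GDERIV f y :> (\<Sum>b\<in>Basis. f' b *\<^sub>R b)" by (simp only: gderiv_def)
  have "g = g'" if "GDERIV f y :> g" "GDERIV f y :> g'" for g g'
  proof -
    have "(\<lambda>h. h \<bullet> g) = (\<lambda>h. h \<bullet> g')"
      using that unfolding gderiv_def by (rule has_derivative_unique)
    then have "h \<bullet> g = h \<bullet> g'" for h by (rule fun_cong)
    then show ?thesis unfolding vector_eq_ldot[symmetric, of g] by (rule allI)
  qed
  note unique = this
  show ?thesis
    unfolding grad_def by (rule theI[where P = "\<lambda>g. GDERIV f y :> g", OF g]) (rule unique[OF _ g])
qed

definition normal_cone :: "'a::real_inner set \<Rightarrow> 'a \<Rightarrow> 'a set" where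
  "normal_cone X x = {w. \<forall>y\<in>X. w \<bullet> (y - x) \<le> 0}"

lemma zero_le_Liminf_iff:
  fixes q :: "'a \<Rightarrow> ereal"
  shows "0 \<le> Liminf F q \<longleftrightarrow> (\<forall>e>0. eventually (\<lambda>y. ereal (- e) < q y) F)"
proof (intro iffI allI impI)
  fix e :: real assume "0 \<le> Liminf F q" "0 < e"
  then show "eventually (\<lambda>y. ereal (- e) < q y) F"
    by (auto simp: le_Liminf_iff)
next
  assume *: "\<forall>e>0. eventually (\<lambda>y. ereal (- e) < q y) F"
  show "0 \<le> Liminf F q"
    unfolding le_Liminf_iff
  proof (intro allI impI)
    fix c :: ereal assume "c < 0"
    then obtain r where r: "c < ereal r" "ereal r < 0" using ereal_dense2 by blast
    then have "eventually (\<lambda>y. ereal (- (- r)) < q y) F"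
      by (intro *[rule_format]) simp
    then show "eventually (\<lambda>y. c < q y) F"
      by eventually_elim (use r in \<open>auto intro: less_trans\<close>)
  qed
qed

lemma GDERIV_bound:
  assumes "GDERIV f x :> D" "0 < e"
  shows "eventually (\<lambda>y. \<bar>f y - f x - D \<bullet> (y - x)\<bar> \<le> e * norm (y - x)) (nhds x)"
proof -
  have "(f has_derivative (\<lambda>h. h \<bullet> D)) (at x)"
    using assms(1) by (simp add: gderiv_def)
  then obtain d where "d > 0"
    and "\<And>y. norm (y - x) < d \<Longrightarrow> norm (f y - f x - (y - x) \<bullet> D) \<le> e * norm (y - x)"
    using assms(2) by (auto simp: has_derivative_at_alt)
  then show ?thesis
    unfolding eventually_nhds_metric by (auto simp: dist_norm inner_commute)
qed

lemma frechet_subdiff_add_indicator: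
  fixes f :: "real ^ 'n \<Rightarrow> real"
  assumes X: "convex X" "x \<in> X" and D: "GDERIV f x :> D"
  shows "frechet_subdiff (\<lambda>y. ereal (f y) + set_indicator X y) x = {v. v - D \<in> normal_cone X x}"
proof -
  define q where "q v y = (ereal (f y) + set_indicator X y - (ereal (f x) + set_indicator X x)
    - ereal (v \<bullet> (y - x))) / ereal (norm (y - x))" for v y
  have qX: "q v y = ereal ((f y - f x - v \<bullet> (y - x)) / norm (y - x))" if "y \<in> X" for v y
    using that X by (simp add: q_def set_indicator_def)
  have qnX: "q v y = \<infinity>" if "y \<notin> X" for v y
  proof -
    have "y \<noteq> x" using that X by auto
    then show ?thesis using that X by (simp add: q_def set_indicator_def)
  qed
  have "0 \<le> Liminf (at x) (q v) \<longleftrightarrow> v - D \<in> normal_cone X x" for v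
    unfolding zero_le_Liminf_iff
  proof (intro iffI allI impI)
    fix e :: real assume N: "v - D \<in> normal_cone X x" and e: "0 < e"
    have "eventually (\<lambda>y. \<bar>f y - f x - D \<bullet> (y - x)\<bar> \<le> (e / 2) * norm (y - x)) (at x)"
      using GDERIV_bound[OF D, of "e / 2"] e
      by (auto simp: at_within_def intro: filter_leD[OF inf_le1])
    moreover have "eventually (\<lambda>y. y \<noteq> x) (at x)"
      by (simp add: eventually_at_filter)
    ultimately show "eventually (\<lambda>y. ereal (- e) < q v y) (at x)"
    proof eventually_elim
      case (elim y)
      show ?case
      proof (cases "y \<in> X")
        case True
        have pos: "0 < norm (y - x)" using elim by simp
        have "(v - D) \<bullet> (y - x) \<le> 0"
          using N True by (simp add: normal_cone_def)
        then have "- (e / 2) * norm (y - x) \<le> f y - f x - v \<bullet> (y - x)"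
          using elim unfolding inner_diff_left by linarith
        moreover have "- e * norm (y - x) < - (e / 2) * norm (y - x)"
          using e pos by (intro mult_strict_right_mono) auto
        ultimately show ?thesis
          using pos unfolding qX[OF True] by (simp add: field_simps)
      qed (simp add: qnX)
    qed
  next
    assume L: "\<forall>e>0. eventually (\<lambda>y. ereal (- e) < q v y) (at x)"
    have "(v - D) \<bullet> (y - x) \<le> 0" if y: "y \<in> X" for y
    proof (cases "y = x")
      case False
      have pos: "0 < norm (y - x)" using False by simp
      have "(v - D) \<bullet> (y - x) / norm (y - x) \<le> 0 + e'" if e': "0 < e'" for e' :: real
      proof -
        define e where "e = e' / 2"
        have e: "0 < e" using e' by (simp add: e_def)
        have "eventually (\<lambda>z. ereal (- e) < q v z) (at x)" using L e by blast
        moreover have "eventually (\<lambda>z. \<bar>f z - f x - D \<bullet> (z - x)\<bar> \<le> e * norm (z - x)) (at x)"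
          using GDERIV_bound[OF D e] by (auto simp: at_within_def intro: filter_leD[OF inf_le1])
        ultimately have "eventually (\<lambda>z. ereal (- e) < q v z \<and>
            \<bar>f z - f x - D \<bullet> (z - x)\<bar> \<le> e * norm (z - x)) (at x)"
          by (rule eventually_conj)
        then obtain d where d: "0 < d" and
          ev: "\<And>z. z \<noteq> x \<Longrightarrow> dist z x < d \<Longrightarrow>
            ereal (- e) < q v z \<and> \<bar>f z - f x - D \<bullet> (z - x)\<bar> \<le> e * norm (z - x)"
          by (auto simp: eventually_at)
        define t where "t = min 1 (d / (2 * norm (y - x)))"
        define z where "z = x + t *\<^sub>R (y - x)"
        have t: "0 < t" "t \<le> 1" using d pos by (auto simp: t_def)
        have zx: "z - x = t *\<^sub>R (y - x)" by (simp add: z_def)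
        have nz: "norm (z - x) = t * norm (y - x)" using t by (simp add: zx)
        have "t * norm (y - x) \<le> d / (2 * norm (y - x)) * norm (y - x)"
          by (intro mult_right_mono) (auto simp: t_def)
        also have "\<dots> < d" using d pos by simp
        finally have "dist z x < d" by (simp add: dist_norm nz)
        moreover have "z \<noteq> x" using t pos by (auto simp: z_def)
        ultimately have *: "ereal (- e) < q v z" "f z - f x - D \<bullet> (z - x) \<le> e * norm (z - x)"
          using ev by force+
        have "z = (1 - t) *\<^sub>R x + t *\<^sub>R y" by (simp add: z_def algebra_simps)
        then have "z \<in> X" using X y t by (simp add: convexD_alt)
        then have "- e * norm (z - x) < f z - f x - v \<bullet> (z - x)"
          using *(1) t pos by (simp add: qX nz field_simps)
        with *(2) have "(v - D) \<bullet> (z - x) \<le> 2 * e * norm (z - x)"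
          by (simp add: inner_diff_left)
        then have "t * ((v - D) \<bullet> (y - x)) \<le> t * (2 * e * norm (y - x))"
          unfolding nz by (simp only: zx inner_scaleR_right mult_ac)
        then have "(v - D) \<bullet> (y - x) \<le> 2 * e * norm (y - x)"
          using t by (simp only: mult_le_cancel_left_pos)
        then show ?thesis using pos by (simp add: pos_divide_le_eq e_def)
      qed
      then have "(v - D) \<bullet> (y - x) / norm (y - x) \<le> 0"
        by (rule field_le_epsilon)
      then show ?thesis using pos by (simp add: divide_le_0_iff)
    qed simp
    then show "v - D \<in> normal_cone X x" by (simp add: normal_cone_def)
  qed
  moreover have "\<bar>ereal (f x) + set_indicator X x\<bar> \<noteq> \<infinity>"
    using X by (simp add: set_indicator_def)
  ultimately show ?thesis
    unfolding frechet_subdiff_def q_def[abs_def] by auto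
qed

text \<open>Sublevel sets are closed because the normal cone has closed graph.\<close>
lemma dist0_inf_normal_cone_borel_measurable:
  fixes D :: "real ^ 'n \<Rightarrow> real ^ 'n"
  assumes X: "closed X" and cont: "continuous_on X D"
  shows "(\<lambda>y. dist0_inf {v. v - D y \<in> normal_cone X y}) \<in> borel_measurable (restrict_space borel X)"
proof (rule borel_measurableI_le)
  fix c :: ennreal
  let ?d = "\<lambda>y. dist0_inf {v. v - D y \<in> normal_cone X y}"
  have "closed {y \<in> X. ?d y \<le> c}"
  proof (cases c)
    case (real r)
    show ?thesis
      unfolding closed_sequential_limits
    proof (intro allI impI, elim conjE)
      fix s l assume s: "\<forall>n. s n \<in> {y \<in> X. ?d y \<le> c}" and sl: "s \<longlonglongrightarrow> l"
      have sX: "s n \<in> X" for n using s by simp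
      have l: "l \<in> X" by (rule closed_sequentially[OF X sX sl])
      have "\<exists>v. v - D (s n) \<in> normal_cone X (s n) \<and> infnorm v < r + 1 / Suc n" for n
      proof -
        have "?d (s n) \<le> ennreal r" using s real by simp
        also have "ennreal r < ennreal (r + 1 / Suc n)"
          using real by (intro ennreal_lessI) (auto intro: add_nonneg_pos)
        finally show ?thesis
          unfolding dist0_inf_def INF_less_iff
          by (auto simp: ennreal_less_iff infnorm_pos_le)
      qed
      then obtain v where v: "\<And>n. v n - D (s n) \<in> normal_cone X (s n)"
        "\<And>n. infnorm (v n) < r + 1 / Suc n" by metis
      have "norm (v n) \<le> sqrt DIM(real ^ 'n) * (r + 1)" for n
      proof -
        have "infnorm (v n) \<le> r + 1" using v(2)[of n]
          by (rule less_imp_le[THEN order_trans]) simp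
        then show ?thesis
          by (intro order_trans[OF norm_le_infnorm] mult_left_mono) auto
      qed
      then have "bounded (range v)" by (auto simp: bounded_iff)
      then obtain w h where h: "strict_mono h" and w: "(v \<circ> h) \<longlonglongrightarrow> w"
        using bounded_imp_convergent_subsequence by blast
      have sh: "(\<lambda>n. s (h n)) \<longlonglongrightarrow> l"
        using LIMSEQ_subseq_LIMSEQ[OF sl h] by (simp add: o_def)
      have w': "(\<lambda>n. v (h n)) \<longlonglongrightarrow> w" using w by (simp add: o_def)
      have Dh: "(\<lambda>n. D (s (h n))) \<longlonglongrightarrow> D l"
        using cont sh l sX by (auto simp: continuous_on_sequentially o_def)
      have "w - D l \<in> normal_cone X l"
        unfolding normal_cone_def
      proof (intro CollectI ballI)
        fix y assume "y \<in> X"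
        then have "(v (h n) - D (s (h n))) \<bullet> (y - s (h n)) \<le> 0" for n
          using v(1)[of "h n"] by (simp add: normal_cone_def)
        moreover have "(\<lambda>n. (v (h n) - D (s (h n))) \<bullet> (y - s (h n))) \<longlonglongrightarrow> (w - D l) \<bullet> (y - l)"
          by (intro tendsto_intros w' Dh sh)
        ultimately show "(w - D l) \<bullet> (y - l) \<le> 0"
          by (intro LIMSEQ_le_const2) auto
      qed
      moreover have "infnorm w \<le> r"
      proof (rule LIMSEQ_le)
        show "(\<lambda>n. infnorm (v (h n))) \<longlonglongrightarrow> infnorm w"
          by (intro tendsto_intros w')
        have "(\<lambda>n. r + 1 / Suc n) \<longlonglongrightarrow> r + 0"
          by (intro tendsto_intros LIMSEQ_Suc lim_1_over_n)
        from LIMSEQ_subseq_LIMSEQ[OF this h]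
        show "(\<lambda>n. r + 1 / Suc (h n)) \<longlonglongrightarrow> r" by (simp add: o_def)
        show "\<exists>N. \<forall>n\<ge>N. infnorm (v (h n)) \<le> r + 1 / Suc (h n)"
          using v(2) by (auto intro: less_imp_le)
      qed
      ultimately have "?d l \<le> ennreal r"
        unfolding dist0_inf_def by (intro INF_lower2[of w]) (auto intro: ennreal_leI)
      then show "l \<in> {y \<in> X. ?d y \<le> c}" using l real by simp
    qed
  qed (simp add: X)
  then have "{y \<in> X. ?d y \<le> c} \<in> sets borel" by (rule borel_closed)
  then show "{y \<in> space (restrict_space borel X). ?d y \<le> c} \<in> sets (restrict_space borel X)"
    using X by (auto simp: space_restrict_space sets_restrict_space_iff)
qed

lemma normal_cone_Int:
  fixes S T :: "'a::euclidean_space set"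
  assumes S: "convex S" "x \<in> S" and T: "convex T" "x \<in> T"
    and int: "S \<inter> interior T \<noteq> {}" and a: "a \<in> normal_cone (S \<inter> T) x"
  obtains v where "v \<in> normal_cone T x" "a - v \<in> normal_cone S x"
proof -
  define A where "A = {(y, s). y \<in> S \<and> s \<le> a \<bullet> (y - x)}"
  define B where "B = interior T \<times> {0::real<..}"
  obtain z where z: "z \<in> S" "z \<in> interior T" using int by blast
  have "convex A"
  proof (rule convexI, clarsimp simp: A_def)
    fix y s y' s' and u v :: real
    assume *: "y \<in> S" "s \<le> a \<bullet> (y - x)" "y' \<in> S" "s' \<le> a \<bullet> (y' - x)" "0 \<le> u" "0 \<le> v" "u + v = 1"
    have "u * s + v * s' \<le> u * (a \<bullet> (y - x)) + v * (a \<bullet> (y' - x))"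
      using * by (intro add_mono mult_left_mono)
    also have "\<dots> = a \<bullet> (u *\<^sub>R y + v *\<^sub>R y' - (u + v) *\<^sub>R x)"
      by (simp add: inner_diff_right inner_add_right algebra_simps)
    finally show "u *\<^sub>R y + v *\<^sub>R y' \<in> S \<and> u * s + v * s' \<le> a \<bullet> (u *\<^sub>R y + v *\<^sub>R y' - x)"
      using * S by (simp add: convexD)
  qed
  moreover have "convex B"
    unfolding B_def by (intro convex_Times convex_interior T) auto
  moreover have "(x, 0) \<in> A" using S by (simp add: A_def)
  moreover have "(z, 1) \<in> B" using z by (simp add: B_def)
  moreover have "A \<inter> B = {}"
  proof -
    have False if "y \<in> S" "s \<le> a \<bullet> (y - x)" "y \<in> interior T" "0 < s" for y s
    proof -
      have "y \<in> S \<inter> T" using that interior_subset by blast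
      then have "a \<bullet> (y - x) \<le> 0" using a by (simp add: normal_cone_def)
      then show False using that by simp
    qed
    then show ?thesis by (auto simp: A_def B_def)
  qed
  ultimately obtain n c where n: "n \<noteq> 0" "\<forall>e\<in>A. n \<bullet> e \<le> c" "\<forall>e\<in>B. n \<bullet> e \<ge> c"
    using separating_hyperplane_sets[of A B] by blast
  obtain p \<tau> where pt: "n = (p, \<tau>)" by (cases n)
  have pA: "p \<bullet> y + \<tau> * s \<le> c" if "y \<in> S" "s \<le> a \<bullet> (y - x)" for y s
    using n(2) that by (auto simp: A_def pt)
  have pB: "c \<le> p \<bullet> b + \<tau> * t" if "b \<in> interior T" "0 < t" for b t
    using n(3) that by (auto simp: B_def pt)
  have \<tau>0: "0 \<le> \<tau>"
  proof (rule ccontr)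
    assume "\<not> 0 \<le> \<tau>"
    then have "\<tau> * ((c - p \<bullet> x + 1) / \<tau>) = c - p \<bullet> x + 1" by simp
    moreover define s where "s = min 0 ((c - p \<bullet> x + 1) / \<tau>)"
    moreover have "\<tau> * ((c - p \<bullet> x + 1) / \<tau>) \<le> \<tau> * s"
      using \<open>\<not> 0 \<le> \<tau>\<close> by (intro mult_left_mono_neg) (auto simp: s_def)
    ultimately show False using pA[of x s] S by (simp add: s_def)
  qed
  have pT': "c \<le> p \<bullet> b" if "b \<in> interior T" for b
  proof (rule field_le_epsilon)
    fix e :: real assume e: "0 < e"
    have "\<tau> * (e / (\<tau> + 1)) \<le> e" using \<tau>0 e by (simp add: field_simps)
    moreover have "c \<le> p \<bullet> b + \<tau> * (e / (\<tau> + 1))" using pB[OF that, of "e / (\<tau> + 1)"] e \<tau>0 by simp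
    ultimately show "c \<le> p \<bullet> b + e" by simp
  qed
  have \<tau>: "0 < \<tau>"
  proof (rule ccontr)
    assume "\<not> 0 < \<tau>"
    then have [simp]: "\<tau> = 0" using \<tau>0 by simp
    have p: "p \<noteq> 0" using n(1) by (simp add: pt zero_prod_def)
    obtain d where d: "0 < d" "cball z d \<subseteq> interior T"
      using open_contains_cball[of "interior T"] z by auto
    define b where "b = z - (d / norm p) *\<^sub>R p"
    have "b \<in> interior T" using d p by (intro subsetD[OF d(2)]) (simp add: b_def dist_norm)
    then have "c \<le> p \<bullet> b" by (rule pT')
    also have "\<dots> = p \<bullet> z - d * norm p"
      using p by (simp add: b_def inner_diff_right dot_square_norm power2_eq_square)
    also have "\<dots> < p \<bullet> z" using d p by simp
    also have "\<dots> \<le> c" using pA[OF z(1), of "a \<bullet> (z - x)"] by simp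
    finally show False by simp
  qed
  have "T \<subseteq> closure (interior T)"
    using convex_closure_interior[OF T(1)] z closure_subset by blast
  also have "\<dots> \<subseteq> {b. p \<bullet> b \<ge> c}"
    using pT' by (intro closure_minimal closed_halfspace_ge) auto
  finally have pT: "c \<le> p \<bullet> b" if "b \<in> T" for b using that by blast
  have c: "c = p \<bullet> x" using pT[OF T(2)] pA[OF S(2), of 0] by simp
  show ?thesis
  proof (rule that[of "- (1 / \<tau>) *\<^sub>R p"])
    show "- (1 / \<tau>) *\<^sub>R p \<in> normal_cone T x"
      using pT \<tau> by (auto simp: normal_cone_def c inner_diff_right divide_simps)
    show "a - - (1 / \<tau>) *\<^sub>R p \<in> normal_cone S x"
      unfolding normal_cone_def
    proof (intro CollectI ballI)
      fix y assume "y \<in> S"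
      from pA[OF this order_refl] have "p \<bullet> (y - x) + \<tau> * (a \<bullet> (y - x)) \<le> 0"
        by (simp add: c inner_diff_right)
      moreover have "(a - - (1 / \<tau>) *\<^sub>R p) \<bullet> (y - x) = (p \<bullet> (y - x) + \<tau> * (a \<bullet> (y - x))) / \<tau>"
        using \<tau> by (simp add: inner_add_left field_simps)
      ultimately show "(a - - (1 / \<tau>) *\<^sub>R p) \<bullet> (y - x) \<le> 0"
        using \<tau> by (simp add: divide_nonpos_pos)
    qed
  qed
qed

lemma normal_cone_l1ball_infnorm:
  assumes v: "v \<in> normal_cone {y. l1norm (y - x) \<le> \<psi>} z" and "0 \<le> \<psi>"
  shows "\<psi> * infnorm v \<le> v \<bullet> (z - x)"
proof -
  obtain i where i: "infnorm v = \<bar>v $ i\<bar>" by (rule infnorm_eq_component)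
  define b where "b = x + (\<psi> * sgn (v $ i)) *\<^sub>R axis i 1"
  have "l1norm (axis i 1 :: real ^ 'a) = 1"
  proof -
    have "\<bar>(axis i 1 :: real ^ 'a) $ j\<bar> = (if j = i then 1 else 0)" for j
      by (simp add: axis_def)
    then show ?thesis by (simp add: l1norm_def)
  qed
  then have "l1norm (b - x) \<le> \<psi>"
    using \<open>0 \<le> \<psi>\<close> by (simp add: b_def l1norm_scaleR abs_mult abs_sgn_eq)
  then have "v \<bullet> (b - z) \<le> 0" using v by (simp add: normal_cone_def)
  moreover have "v \<bullet> (b - x) = \<psi> * infnorm v"
    by (simp add: b_def inner_axis i abs_sgn mult_ac)
  ultimately show ?thesis by (simp add: inner_diff_right)
qed

lemma l1_smooth_descent:
  fixes f :: "real ^ 'n \<Rightarrow> real"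
  assumes X: "convex X" "x \<in> X" "y \<in> X"
    and D: "\<And>z. GDERIV f z :> D z"
    and lip: "\<And>y z. y \<in> X \<Longrightarrow> z \<in> X \<Longrightarrow> infnorm (D y - D z) \<le> L * l1norm (y - z)"
  shows "f y \<le> f x + D x \<bullet> (y - x) + L / 2 * (l1norm (y - x))\<^sup>2"
proof -
  define N where "N = l1norm (y - x)"
  define h where "h t = f (x + t *\<^sub>R (y - x)) - t * (D x \<bullet> (y - x)) - L / 2 * N\<^sup>2 * t\<^sup>2" for t
  have der: "(h has_real_derivative
      (D (x + t *\<^sub>R (y - x)) \<bullet> (y - x) - D x \<bullet> (y - x) - L * N\<^sup>2 * t)) (at t)" for t
  proof -
    have f: "(f has_derivative (\<lambda>h. h \<bullet> D (x + t *\<^sub>R (y - x)))) (at (x + t *\<^sub>R (y - x)))"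
      using D by (simp add: gderiv_def)
    have "((\<lambda>t. x + t *\<^sub>R (y - x)) has_derivative (\<lambda>s. s *\<^sub>R (y - x))) (at t)"
      by (auto intro!: derivative_eq_intros)
    from has_derivative_compose[OF this f] have "((\<lambda>t. f (x + t *\<^sub>R (y - x))) has_derivative
        (\<lambda>s. (s *\<^sub>R (y - x)) \<bullet> D (x + t *\<^sub>R (y - x)))) (at t)" .
    then have "((\<lambda>t. f (x + t *\<^sub>R (y - x))) has_real_derivative D (x + t *\<^sub>R (y - x)) \<bullet> (y - x)) (at t)"
      unfolding has_field_derivative_def by (rule has_derivative_eq_rhs) (auto simp: inner_commute)
    then show ?thesis
      unfolding h_def by (auto intro!: derivative_eq_intros)
  qed
  have "h 1 \<le> h 0"
  proof (rule DERIV_nonpos_imp_nonincreasing[of 0 1 h])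
    fix t :: real assume t: "0 \<le> t" "t \<le> 1"
    have "x + t *\<^sub>R (y - x) = (1 - t) *\<^sub>R x + t *\<^sub>R y" by (simp add: algebra_simps)
    then have "x + t *\<^sub>R (y - x) \<in> X" using X t by (simp add: convexD_alt)
    then have "infnorm (D (x + t *\<^sub>R (y - x)) - D x) \<le> L * (t * N)"
      using lip[of "x + t *\<^sub>R (y - x)" x] X t by (simp add: l1norm_scaleR N_def)
    then have "infnorm (D (x + t *\<^sub>R (y - x)) - D x) * N \<le> L * (t * N) * N"
      by (intro mult_right_mono) (auto simp: N_def)
    moreover have "(D (x + t *\<^sub>R (y - x)) - D x) \<bullet> (y - x) \<le> infnorm (D (x + t *\<^sub>R (y - x)) - D x) * N"
      unfolding N_def by (rule inner_le_infnorm_l1norm)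
    ultimately have "D (x + t *\<^sub>R (y - x)) \<bullet> (y - x) - D x \<bullet> (y - x) - L * N\<^sup>2 * t \<le> 0"
      by (simp add: inner_diff_left power2_eq_square mult_ac)
    then show "\<exists>y. DERIV h t :> y \<and> y \<le> 0" using der by blast
  qed simp
  then show ?thesis by (simp add: h_def N_def)
qed

definition l1_prox :: "(real ^ 'n) set \<Rightarrow> real \<Rightarrow> real ^ 'n \<Rightarrow> real ^ 'n \<Rightarrow> real ^ 'n" where
  "l1_prox X \<psi> x u = closest_point (X \<inter> {y. l1norm (y - x) \<le> \<psi>}) u"

context
  fixes X :: "(real ^ 'n) set" and \<psi> :: real
  assumes X: "closed X" "convex X" and \<psi>: "0 < \<psi>"
begin

lemma l1_prox_in:
  assumes "x \<in> X"
  shows "l1_prox X \<psi> x u \<in> X" "l1norm (l1_prox X \<psi> x u - x) \<le> \<psi>"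
proof -
  have "x \<in> X \<inter> {y. l1norm (y - x) \<le> \<psi>}" using assms \<psi> by simp
  then have "l1_prox X \<psi> x u \<in> X \<inter> {y. l1norm (y - x) \<le> \<psi>}"
    unfolding l1_prox_def by (intro closest_point_in_set closed_Int X closed_l1ball) auto
  then show "l1_prox X \<psi> x u \<in> X" "l1norm (l1_prox X \<psi> x u - x) \<le> \<psi>" by auto
qed

lemma l1_prox_normal:
  "u - l1_prox X \<psi> x u \<in> normal_cone (X \<inter> {y. l1norm (y - x) \<le> \<psi>}) (l1_prox X \<psi> x u)"
  unfolding normal_cone_def l1_prox_def
  by (intro CollectI ballI closest_point_dot convex_Int X convex_l1ball closed_Int closed_l1ball)

lemma l1_prox_eqI:
  assumes y: "is_arg_min (\<lambda>y. ereal (1 / 2 * (norm (y - u))\<^sup>2) +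
      set_indicator {z. l1norm z \<le> \<psi>} (y - x)) (\<lambda>y. y \<in> X) y"
    and x: "x \<in> X"
  shows "y = l1_prox X \<psi> x u"
proof -
  let ?F = "\<lambda>y. ereal (1 / 2 * (norm (y - u))\<^sup>2) + set_indicator {z. l1norm z \<le> \<psi>} (y - x)"
  have yX: "y \<in> X" using y by (simp add: is_arg_min_def)
  have min: "?F y \<le> ?F z" if "z \<in> X" for z
    using y that by (auto simp: is_arg_min_def not_less)
  have yb: "l1norm (y - x) \<le> \<psi>"
  proof (rule ccontr)
    assume "\<not> l1norm (y - x) \<le> \<psi>"
    then have "?F y = \<infinity>" by (simp add: set_indicator_def)
    then show False using min[OF x] \<psi> by (simp add: set_indicator_def)
  qed
  show ?thesis
    unfolding l1_prox_def
  proof (intro closest_point_unique convex_Int X convex_l1ball closed_Int closed_l1ball ballI)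
    show "y \<in> X \<inter> {y. l1norm (y - x) \<le> \<psi>}" using yX x yb by simp
    fix z assume z: "z \<in> X \<inter> {y. l1norm (y - x) \<le> \<psi>}"
    then have "(norm (y - u))\<^sup>2 \<le> (norm (z - u))\<^sup>2"
      using min[of z] yb by (simp add: set_indicator_def)
    then show "dist u y \<le> dist u z"
      by (metis dist_commute dist_norm norm_ge_zero power2_le_imp_le)
  qed
qed

text \<open>Pulling a point feasible around \<open>x'\<close> towards \<open>x\<close> makes it feasible around \<open>x\<close>,
  so the variational inequality at \<open>x\<close> can be tested against it up to an error.\<close>
lemma l1_prox_inner_le:
  assumes x: "x \<in> X" and x': "x' \<in> X"
  shows "(u - l1_prox X \<psi> x u) \<bullet> (l1_prox X \<psi> x' u' - l1_prox X \<psi> x u)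
    \<le> norm (u - l1_prox X \<psi> x u) * l1norm (x - x')"
proof -
  define y y' r where "y = l1_prox X \<psi> x u" and "y' = l1_prox X \<psi> x' u'" and "r = l1norm (x - x')"
  define t where "t = r / (\<psi> + r)"
  have r: "0 \<le> r" by (simp add: r_def)
  have t: "0 \<le> t" "t \<le> 1" and t': "t * (\<psi> + r) = r" "(1 - t) * (\<psi> + r) = \<psi>"
    using r \<psi> by (auto simp: t_def field_simps add_pos_nonneg)
  define z where "z = (1 - t) *\<^sub>R y' + t *\<^sub>R x"
  have "y' - x = (y' - x') + (x' - x)" by simp
  then have y'x: "l1norm (y' - x) \<le> \<psi> + r"
    using l1norm_triangle[of "y' - x'" "x' - x"] l1_prox_in(2)[OF x', of u']
    by (simp add: y'_def r_def l1norm_minus_commute)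
  have zx: "z - x = (1 - t) *\<^sub>R (y' - x)" by (simp add: z_def algebra_simps)
  have "l1norm (z - x) \<le> (1 - t) * (\<psi> + r)"
    using mult_left_mono[OF y'x, of "1 - t"] t by (simp add: zx l1norm_scaleR)
  moreover have "z \<in> X"
    unfolding z_def y'_def using t X x l1_prox_in[OF x'] by (simp add: convexD_alt)
  ultimately have "(u - y) \<bullet> (z - y) \<le> 0"
    using l1_prox_normal[of u x] t' by (simp add: normal_cone_def y_def)
  then have "(u - y) \<bullet> (y' - y) \<le> (u - y) \<bullet> (y' - z)"
    by (simp add: inner_diff_right)
  also have "\<dots> \<le> norm (u - y) * norm (y' - z)"
    by (rule norm_cauchy_schwarz)
  also have "y' - z = t *\<^sub>R (y' - x)" by (simp add: z_def algebra_simps)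
  also have "norm (t *\<^sub>R (y' - x)) \<le> t * (\<psi> + r)"
    using order_trans[OF norm_le_l1norm y'x] t by (simp add: mult_left_mono)
  finally show ?thesis
    using t' by (simp add: y_def y'_def r_def mult_left_mono)
qed

lemma l1_prox_dist_le:
  assumes x: "x \<in> X" and x': "x' \<in> X"
  defines "r \<equiv> l1norm (x - x')"
  shows "(norm (l1_prox X \<psi> x' u' - l1_prox X \<psi> x u))\<^sup>2
    \<le> norm (u - u') * (2 * \<psi> + r) + r * (norm (u - x) + norm (u' - x') + 2 * \<psi>)"
proof -
  define y y' where "y = l1_prox X \<psi> x u" and "y' = l1_prox X \<psi> x' u'"
  have y: "norm (y - x) \<le> \<psi>" and y': "norm (y' - x') \<le> \<psi>"
    using l1_prox_in(2)[OF x] l1_prox_in(2)[OF x'] norm_le_l1norm order_trans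
    unfolding y_def y'_def by blast+
  have xx': "norm (x - x') \<le> r" unfolding r_def by (rule norm_le_l1norm)
  have r: "0 \<le> r" by (simp add: r_def)
  have uy: "norm (u - y) \<le> norm (u - x) + \<psi>"
    using y norm_triangle_ineq4[of "u - x" "y - x"] by simp
  have uy': "norm (u' - y') \<le> norm (u' - x') + \<psi>"
    using y' norm_triangle_ineq4[of "u' - x'" "y' - x'"] by simp
  have "y' - y = (y' - x') - (y - x) - (x - x')" by simp
  then have yy': "norm (y' - y) \<le> 2 * \<psi> + r"
    using norm_triangle_ineq4[of "(y' - x') - (y - x)" "x - x'"]
      norm_triangle_ineq4[of "y' - x'" "y - x"] y y' xx' by simp
  have 1: "(u - y) \<bullet> (y' - y) \<le> norm (u - y) * r"
    unfolding y_def y'_def r_def by (rule l1_prox_inner_le[OF x x'])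
  have 2: "(u' - y') \<bullet> (y - y') \<le> norm (u' - y') * r"
    unfolding y_def y'_def r_def l1norm_minus_commute[of x] by (rule l1_prox_inner_le[OF x' x])
  have "(norm (y' - y))\<^sup>2 = (u - y) \<bullet> (y' - y) + (u' - y') \<bullet> (y - y') + (u' - u) \<bullet> (y' - y)"
    by (simp add: power2_norm_eq_inner inner_diff_left inner_diff_right inner_commute)
  also have "(u' - u) \<bullet> (y' - y) \<le> norm (u' - u) * norm (y' - y)"
    by (rule norm_cauchy_schwarz)
  also have "\<dots> \<le> norm (u - u') * (2 * \<psi> + r)"
    using yy' by (simp add: mult_left_mono norm_minus_commute)
  also note 1
  also note 2
  also have "norm (u - y) * r + norm (u' - y') * r \<le> r * (norm (u - x) + norm (u' - x') + 2 * \<psi>)"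
    using mult_right_mono[OF uy r] mult_right_mono[OF uy' r] by (simp add: algebra_simps)
  finally show ?thesis by (simp add: y_def y'_def)
qed

lemma continuous_on_l1_prox: "continuous_on (X \<times> UNIV) (\<lambda>(x, u). l1_prox X \<psi> x u)"
  unfolding continuous_on_def
proof
  fix p0 :: "(real ^ 'n) \<times> (real ^ 'n)" assume p0: "p0 \<in> X \<times> UNIV"
  let ?F = "at p0 within X \<times> UNIV"
  define R where "R p = norm (snd p0 - snd p) * (2 * \<psi> + l1norm (fst p0 - fst p)) +
    l1norm (fst p0 - fst p) * (norm (snd p0 - fst p0) + norm (snd p - fst p) + 2 * \<psi>)" for p
  have id: "((\<lambda>p. p) \<longlongrightarrow> p0) ?F" by (rule tendsto_ident_at)
  have "((\<lambda>p. l1norm (fst p0 - fst p)) \<longlongrightarrow> l1norm (fst p0 - fst p0)) ?F"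
    unfolding l1norm_def by (intro tendsto_intros id)
  then have "(R \<longlongrightarrow> norm (snd p0 - snd p0) * (2 * \<psi> + l1norm (fst p0 - fst p0)) +
      l1norm (fst p0 - fst p0) * (norm (snd p0 - fst p0) + norm (snd p0 - fst p0) + 2 * \<psi>)) ?F"
    unfolding R_def by (intro tendsto_intros id)
  then have "(R \<longlongrightarrow> 0) ?F" by simp
  from tendsto_real_sqrt[OF this] have "((\<lambda>p. sqrt (R p)) \<longlongrightarrow> 0) ?F" by simp
  moreover have "eventually (\<lambda>p. norm ((\<lambda>(x, u). l1_prox X \<psi> x u) p - (\<lambda>(x, u). l1_prox X \<psi> x u) p0)
      \<le> sqrt (R p)) ?F"
    unfolding eventually_at_filter
    using l1_prox_dist_le p0
    by (intro always_eventually) (auto simp: R_def intro!: real_le_rsqrt)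
  ultimately have "((\<lambda>p. (\<lambda>(x, u). l1_prox X \<psi> x u) p - (\<lambda>(x, u). l1_prox X \<psi> x u) p0) \<longlongrightarrow> 0) ?F"
    by (rule Lim_null_comparison[rotated])
  then show "((\<lambda>(x, u). l1_prox X \<psi> x u) \<longlongrightarrow> (\<lambda>(x, u). l1_prox X \<psi> x u) p0) ?F"
    by (simp only: LIM_zero_iff)
qed

lemma l1_prox_decomposition:
  assumes x: "x \<in> X"
  obtains v where "\<psi> * infnorm v \<le> v \<bullet> (l1_prox X \<psi> x u - x)"
    "u - l1_prox X \<psi> x u - v \<in> normal_cone X (l1_prox X \<psi> x u)"
proof -
  let ?T = "{y. l1norm (y - x) \<le> \<psi>}"
  have "open {y. l1norm (y - x) < \<psi>}"
    by (intro open_Collect_less continuous_intros)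
  then have "x \<in> interior ?T"
    using \<psi> by (intro interiorI[of "{y. l1norm (y - x) < \<psi>}"]) auto
  then have "X \<inter> interior ?T \<noteq> {}" using x by blast
  then obtain v where "v \<in> normal_cone ?T (l1_prox X \<psi> x u)"
    "u - l1_prox X \<psi> x u - v \<in> normal_cone X (l1_prox X \<psi> x u)"
    using normal_cone_Int[OF X(2) _ convex_l1ball _ _ l1_prox_normal] l1_prox_in[OF x] by blast
  then show ?thesis
    using that normal_cone_l1ball_infnorm \<psi> less_imp_le by blast
qed

end

lemma l1_prox_step_dist:
  fixes f :: "real ^ 'n \<Rightarrow> real" and x g :: "real ^ 'n"
  assumes X: "closed X" "convex X" "x \<in> X"
    and D: "\<And>z. GDERIV f z :> D z"
    and lip: "\<And>y z. y \<in> X \<Longrightarrow> z \<in> X \<Longrightarrow> infnorm (D y - D z) \<le> L * l1norm (y - z)"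
    and L: "0 < L" and \<epsilon>: "0 < \<epsilon>"
  defines "y \<equiv> l1_prox X (\<epsilon> / L) x (x - (1 / L) *\<^sub>R g)"
  shows "\<exists>v. v - D y \<in> normal_cone X y \<and>
    infnorm v \<le> 5 / 2 * \<epsilon> + 2 * infnorm (g - D x) + L / \<epsilon> * (f x - f y)"
proof -
  define \<psi> where "\<psi> = \<epsilon> / L"
  have \<psi>: "0 < \<psi>" and L\<psi>: "L * \<psi> = \<epsilon>" using L \<epsilon> by (auto simp: \<psi>_def)
  define \<delta> where "\<delta> = infnorm (g - D x)"
  define z where "z = y - x"
  have yX: "y \<in> X" and z\<psi>: "l1norm z \<le> \<psi>"
    using l1_prox_in[OF X(1,2) \<psi> X(3)] by (auto simp: y_def z_def \<psi>_def)
  obtain v where v: "\<psi> * infnorm v \<le> v \<bullet> z"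
    and w: "x - (1 / L) *\<^sub>R g - y - v \<in> normal_cone X y"
    using l1_prox_decomposition[OF X(1,2) \<psi> X(3), of "x - (1 / L) *\<^sub>R g"]
    by (auto simp: y_def z_def \<psi>_def)
  define a where "a = x - (1 / L) *\<^sub>R g - y - v"
  have "a \<bullet> (x - y) \<le> 0" using w X by (simp add: normal_cone_def a_def)
  then have "L * (a \<bullet> (x - y)) \<le> 0" using L by (simp add: mult_le_0_iff)
  moreover have "L * (a \<bullet> (x - y)) = L * (z \<bullet> z) + g \<bullet> z + L * (v \<bullet> z)"
    using L by (simp add: a_def z_def inner_diff_left inner_diff_right inner_commute algebra_simps)
  moreover have "0 \<le> L * (z \<bullet> z)" using L by simp
  moreover have "L * (\<psi> * infnorm v) \<le> L * (v \<bullet> z)" using v L by simp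
  moreover have "L * (\<psi> * infnorm v) = \<epsilon> * infnorm v" by (simp flip: L\<psi>)
  ultimately have gz: "g \<bullet> z \<le> - (\<epsilon> * infnorm v)" by linarith
  have "(D x - g) \<bullet> z \<le> infnorm (D x - g) * l1norm z"
    by (rule inner_le_infnorm_l1norm)
  also have "\<dots> \<le> \<delta> * \<psi>"
    unfolding \<delta>_def infnorm_sub[of "D x"] by (intro mult_left_mono z\<psi> infnorm_pos_le)
  finally have dz: "D x \<bullet> z \<le> g \<bullet> z + \<delta> * \<psi>" by (simp add: inner_diff_left)
  have "f y \<le> f x + D x \<bullet> z + L / 2 * (l1norm z)\<^sup>2"
    unfolding z_def using X yX D lip by (intro l1_smooth_descent[of X]) auto
  also have "L / 2 * (l1norm z)\<^sup>2 \<le> L / 2 * \<psi>\<^sup>2"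
    using L z\<psi> by (intro mult_left_mono power_mono) auto
  also have "\<dots> = \<epsilon> * \<psi> / 2" by (simp add: power2_eq_square flip: L\<psi>)
  finally have "\<epsilon> * infnorm v \<le> f x - f y + \<delta> * \<psi> + \<epsilon> * \<psi> / 2"
    using gz dz by simp
  then have "L / \<epsilon> * (\<epsilon> * infnorm v) \<le> L / \<epsilon> * (f x - f y + \<delta> * \<psi> + \<epsilon> * \<psi> / 2)"
    using L \<epsilon> by (intro mult_left_mono) auto
  also have "\<dots> = L / \<epsilon> * (f x - f y) + \<delta> + \<epsilon> / 2"
    using L \<epsilon> by (simp add: \<psi>_def field_simps)
  finally have Lv: "L * infnorm v \<le> L / \<epsilon> * (f x - f y) + \<delta> + \<epsilon> / 2"
    using \<epsilon> by simp
  have "infnorm (D y + L *\<^sub>R a) \<le> infnorm (D y - D x) + infnorm (D x - g) + infnorm (- (L *\<^sub>R z)) + infnorm (- (L *\<^sub>R v))"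
  proof -
    have decomp: "D y + L *\<^sub>R a = (D y - D x) + ((D x - g) + (- (L *\<^sub>R z) + - (L *\<^sub>R v)))"
      using L by (simp add: a_def z_def algebra_simps)
    show ?thesis
      unfolding decomp using infnorm_triangle[of "D y - D x" "(D x - g) + (- (L *\<^sub>R z) + - (L *\<^sub>R v))"]
        infnorm_triangle[of "D x - g" "- (L *\<^sub>R z) + - (L *\<^sub>R v)"]
        infnorm_triangle[of "- (L *\<^sub>R z)" "- (L *\<^sub>R v)"] by linarith
  qed
  also have "infnorm (D y - D x) \<le> \<epsilon>"
    using lip[OF yX X(3)] mult_left_mono[OF z\<psi>, of L] L L\<psi> by (simp add: z_def)
  also have "infnorm (D x - g) = \<delta>" by (simp add: \<delta>_def infnorm_sub)
  also have "infnorm (- (L *\<^sub>R z)) \<le> \<epsilon>"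
    using mult_left_mono[OF order_trans[OF infnorm_le_l1norm z\<psi>], of L] L L\<psi>
    by (simp add: infnorm_neg infnorm_mul)
  also have "infnorm (- (L *\<^sub>R v)) \<le> L / \<epsilon> * (f x - f y) + \<delta> + \<epsilon> / 2"
    using Lv L by (simp add: infnorm_neg infnorm_mul)
  finally have "infnorm (D y + L *\<^sub>R a) \<le> 5 / 2 * \<epsilon> + 2 * \<delta> + L / \<epsilon> * (f x - f y)"
    by simp
  moreover have "L *\<^sub>R a \<in> normal_cone X y"
    using w L by (auto simp: normal_cone_def a_def mult_le_0_iff)
  ultimately show ?thesis
    unfolding \<delta>_def by (intro exI[of _ "D y + L *\<^sub>R a"]) auto
qed

lemma (in prob_space) nn_integral_smax_add_le:
  fixes W :: "'a \<Rightarrow> real ^ 'n"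
  assumes W: "integrable M W" "expectation W = 0"
    and sq: "integrable M (\<lambda>z. (infnorm (W z))\<^sup>2)" "expectation (\<lambda>z. (infnorm (W z))\<^sup>2) \<le> v"
  shows "(\<integral>\<^sup>+z. ennreal (smax (s + \<beta> *\<^sub>R W z)) \<partial>M) \<le> ennreal (smax s + \<beta>\<^sup>2 * v / 2)"
proof -
  obtain q where q: "\<And>w. smax (s + w) \<le> smax s + q \<bullet> w + (infnorm w)\<^sup>2 / 2"
    using smax_smooth by blast
  define u where "u z = smax s + \<beta> * (q \<bullet> W z) + \<beta>\<^sup>2 / 2 * (infnorm (W z))\<^sup>2" for z
  have le: "smax (s + \<beta> *\<^sub>R W z) \<le> u z" for z
    using q[of "\<beta> *\<^sub>R W z"] by (simp add: u_def infnorm_mul power_mult_distrib)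
  have int: "integrable M u"
    unfolding u_def using W sq by (intro Bochner_Integration.integrable_add integrable_mult_right) auto
  have "(\<integral>\<^sup>+z. ennreal (smax (s + \<beta> *\<^sub>R W z)) \<partial>M) \<le> (\<integral>\<^sup>+z. ennreal (u z) \<partial>M)"
    by (intro nn_integral_mono ennreal_leI le)
  also have "\<dots> = ennreal (expectation u)"
    using int order_trans[OF smax_nonneg le] by (intro nn_integral_eq_integral) auto
  also have "expectation u = smax s + \<beta> * (q \<bullet> expectation W) +
      \<beta>\<^sup>2 / 2 * expectation (\<lambda>z. (infnorm (W z))\<^sup>2)"
    unfolding u_def using W sq by (simp add: prob_space)
  also have "\<dots> \<le> smax s + \<beta>\<^sup>2 * v / 2"
    using W sq by (simp add: mult_left_mono)
  finally show ?thesis by (simp add: ennreal_leI)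
qed

lemma (in prob_space) nn_integral_indep_pair:
  assumes U: "random_variable A U" and V: "random_variable B V"
    and indep: "indep_set {U -` S \<inter> space M |S. S \<in> sets A} {V -` S \<inter> space M |S. S \<in> sets B}"
    and h: "h \<in> borel_measurable (A \<Otimes>\<^sub>M B)"
  shows "(\<integral>\<^sup>+\<omega>. h (U \<omega>, V \<omega>) \<partial>M) = (\<integral>\<^sup>+\<omega>. (\<integral>\<^sup>+z. h (U \<omega>, z) \<partial>distr M B V) \<partial>M)"
proof -
  interpret U: prob_space "distr M A U" by (rule prob_space_distr) (rule U)
  interpret V: prob_space "distr M B V" by (rule prob_space_distr) (rule V)
  note U [measurable] V [measurable]
  have sets_pair: "sets (distr M A U \<Otimes>\<^sub>M distr M B V) = sets (A \<Otimes>\<^sub>M B)"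
    by (intro sets_pair_measure_cong sets_distr)
  have prod: "distr M A U \<Otimes>\<^sub>M distr M B V = distr M (A \<Otimes>\<^sub>M B) (\<lambda>\<omega>. (U \<omega>, V \<omega>))"
  proof (rule pair_measure_eqI)
    fix S T assume "S \<in> sets (distr M A U)" "T \<in> sets (distr M B V)"
    then have [measurable]: "S \<in> sets A" "T \<in> sets B" by auto
    have "prob ((U -` S \<inter> space M) \<inter> (V -` T \<inter> space M)) = prob (U -` S \<inter> space M) * prob (V -` T \<inter> space M)"
      by (rule indep_setD[OF indep]) auto
    moreover have "(\<lambda>\<omega>. (U \<omega>, V \<omega>)) -` (S \<times> T) \<inter> space M = (U -` S \<inter> space M) \<inter> (V -` T \<inter> space M)"
      by auto
    ultimately show "emeasure (distr M A U) S * emeasure (distr M B V) T =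
        emeasure (distr M (A \<Otimes>\<^sub>M B) (\<lambda>\<omega>. (U \<omega>, V \<omega>))) (S \<times> T)"
      by (simp add: emeasure_distr emeasure_eq_measure ennreal_mult)
  qed (auto simp: sets_pair U.sigma_finite_measure_axioms V.sigma_finite_measure_axioms)
  have h': "h \<in> borel_measurable (distr M A U \<Otimes>\<^sub>M distr M B V)"
    by (simp only: measurable_cong_sets[OF sets_pair refl] h)
  have "(\<integral>\<^sup>+\<omega>. h (U \<omega>, V \<omega>) \<partial>M) = (\<integral>\<^sup>+p. h p \<partial>(distr M A U \<Otimes>\<^sub>M distr M B V))"
    unfolding prod using h by (subst nn_integral_distr) auto
  also have "\<dots> = (\<integral>\<^sup>+u. (\<integral>\<^sup>+z. h (u, z) \<partial>distr M B V) \<partial>distr M A U)"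
    by (rule V.nn_integral_fst[OF h', symmetric])
  also have "\<dots> = (\<integral>\<^sup>+\<omega>. (\<integral>\<^sup>+z. h (U \<omega>, z) \<partial>distr M B V) \<partial>M)"
    by (intro nn_integral_distr V.borel_measurable_nn_integral_fst h' U)
  finally show ?thesis .
qed

lemma (in prob_space) measurable_sources:
  assumes "indep_sets E I" "J \<subseteq> I" and U: "U \<in> measurable (sigma (space M) (\<Union>s\<in>J. E s)) A"
  shows "random_variable A U"
    "{U -` S \<inter> space M |S. S \<in> sets A} \<subseteq> sigma_sets (space M) (\<Union>s\<in>J. E s)"
proof -
  have sub: "(\<Union>s\<in>J. E s) \<subseteq> events"
    using assms(1,2) by (auto simp: indep_sets_def)
  then have "sets (sigma (space M) (\<Union>s\<in>J. E s)) = sigma_sets (space M) (\<Union>s\<in>J. E s)"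
    using sets.space_closed by (intro sets_measure_of) blast
  then have pre: "U -` S \<inter> space M \<in> sigma_sets (space M) (\<Union>s\<in>J. E s)" if "S \<in> sets A" for S
    using measurable_sets[OF U that] by (simp add: space_measure_of_conv)
  then show "{U -` S \<inter> space M |S. S \<in> sets A} \<subseteq> sigma_sets (space M) (\<Union>s\<in>J. E s)"
    by blast
  have "sigma_sets (space M) (\<Union>s\<in>J. E s) \<subseteq> events"
    by (intro sets.sigma_sets_subset sub)
  then show "random_variable A U"
    using pre measurable_space[OF U] by (intro measurableI) (auto simp: space_measure_of_conv)
qed

lemma (in prob_space) indep_set_disjoint_sources:
  assumes indep: "indep_sets E I" and stable: "\<And>s. s \<in> I \<Longrightarrow> Int_stable (E s)"
    and J: "J \<subseteq> I" "J' \<subseteq> I" "J \<inter> J' = {}"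
  shows "indep_set (sigma_sets (space M) (\<Union>s\<in>J. E s)) (sigma_sets (space M) (\<Union>s\<in>J'. E s))"
proof -
  define C where "C = case_bool J J'"
  have C: "(\<Union>b. C b) \<subseteq> I" "disjoint_family_on C UNIV"
    using J by (auto simp: C_def disjoint_family_on_def split: bool.splits)
  have "indep_sets (\<lambda>b. sigma_sets (space M) (\<Union>s\<in>C b. E s)) UNIV"
    using indep_sets_mono_index[OF C(1) indep] stable C
    by (intro indep_sets_collect_sigma) auto
  then show ?thesis
    unfolding indep_set_def
    by (rule indep_sets_mono_sets) (auto simp: C_def split: bool.split)
qed

lemma (in prob_space) nn_integral_disjoint_sources:
  assumes indep: "indep_sets E I" and stable: "\<And>s. s \<in> I \<Longrightarrow> Int_stable (E s)"
    and J: "J \<subseteq> I" "J' \<subseteq> I" "J \<inter> J' = {}"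
    and U: "U \<in> measurable (sigma (space M) (\<Union>s\<in>J. E s)) A"
    and V: "V \<in> measurable (sigma (space M) (\<Union>s\<in>J'. E s)) B"
    and h: "h \<in> borel_measurable (A \<Otimes>\<^sub>M B)"
  shows "(\<integral>\<^sup>+\<omega>. h (U \<omega>, V \<omega>) \<partial>M) = (\<integral>\<^sup>+\<omega>. (\<integral>\<^sup>+z. h (U \<omega>, z) \<partial>distr M B V) \<partial>M)"
proof (rule nn_integral_indep_pair[OF _ _ _ h])
  show "indep_set {U -` S \<inter> space M |S. S \<in> sets A} {V -` S \<inter> space M |S. S \<in> sets B}"
    unfolding indep_set_def
    by (rule indep_sets_mono_sets[OF indep_set_disjoint_sources[OF indep stable J, unfolded indep_set_def]])
      (use measurable_sources(2)[OF indep J(1) U] measurable_sources(2)[OF indep J(2) V]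
        in \<open>simp_all split: bool.split\<close>)
qed (fact measurable_sources(1)[OF indep J(1) U] measurable_sources(1)[OF indep J(2) V])+

lemma measurable_sigma_vimage_algebra:
  assumes "s \<in> J" "E s = sets (vimage_algebra \<Omega> R N)" "R \<in> \<Omega> \<rightarrow> space N"
    and "\<And>s. s \<in> J \<Longrightarrow> E s \<subseteq> Pow \<Omega>"
  shows "R \<in> measurable (sigma \<Omega> (\<Union>s\<in>J. E s)) N"
proof (rule measurableI)
  fix S assume "S \<in> sets N"
  then have "R -` S \<inter> \<Omega> \<in> E s" unfolding assms(2) by (rule in_vimage_algebra)
  then have "R -` S \<inter> \<Omega> \<in> sigma_sets \<Omega> (\<Union>s\<in>J. E s)" using assms(1) by (intro sigma_sets.Basic) auto
  moreover have "(\<Union>s\<in>J. E s) \<subseteq> Pow \<Omega>" using assms(4) by blast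
  ultimately show "R -` S \<inter> space (sigma \<Omega> (\<Union>s\<in>J. E s)) \<in> sets (sigma \<Omega> (\<Union>s\<in>J. E s))"
    by (simp add: space_measure_of sets_measure_of)
qed (use assms in \<open>auto simp: space_measure_of_conv\<close>)

locale l1_prox_method = prob_space M
  for M :: "'w measure" +
  fixes \<Xi> :: "'z measure" and X :: "(real ^ 'n) set"
    and f :: "real ^ 'n \<Rightarrow> real" and D :: "real ^ 'n \<Rightarrow> real ^ 'n"
    and G :: "real ^ 'n \<Rightarrow> 'z \<Rightarrow> real ^ 'n"
    and \<zeta> :: "'w \<Rightarrow> 'z" and Z :: "nat \<Rightarrow> nat \<Rightarrow> 'w \<Rightarrow> 'z"
    and x :: "nat \<Rightarrow> 'w \<Rightarrow> real ^ 'n" and Y :: "'w \<Rightarrow> nat"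
    and \<sigma> L flow \<epsilon> :: real and K m :: nat
  assumes closed_X: "closed X" and convex_X: "convex X"
    and \<zeta>: "\<zeta> \<in> measurable M \<Xi>"
    and G: "(\<lambda>(y, z). G y z) \<in> borel_measurable (restrict_space borel X \<Otimes>\<^sub>M \<Xi>)"
    and G_int: "\<And>y. y \<in> X \<Longrightarrow> integrable M (\<lambda>\<omega>. G y (\<zeta> \<omega>))"
    and G_mean: "\<And>y. y \<in> X \<Longrightarrow> expectation (\<lambda>\<omega>. G y (\<zeta> \<omega>)) = D y"
    and var_int: "\<And>y. y \<in> X \<Longrightarrow> integrable M (\<lambda>\<omega>. (infnorm (G y (\<zeta> \<omega>) - D y))\<^sup>2)"
    and var_le: "\<And>y. y \<in> X \<Longrightarrow> expectation (\<lambda>\<omega>. (infnorm (G y (\<zeta> \<omega>) - D y))\<^sup>2) \<le> \<sigma>\<^sup>2"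
    and D: "\<And>y. GDERIV f y :> D y"
    and lip: "\<And>y z. y \<in> X \<Longrightarrow> z \<in> X \<Longrightarrow> infnorm (D y - D z) \<le> L * l1norm (y - z)"
    and flow: "\<And>y. y \<in> X \<Longrightarrow> flow \<le> f y"
    and pos: "0 < \<sigma>" "0 < L" "0 < \<epsilon>" "0 < K" "0 < m"
    and dim: "CARD('n) \<ge> 2"
    and m: "exp 1 ^ 2 * ln (real CARD('n)) * \<sigma>\<^sup>2 / \<epsilon>\<^sup>2 \<le> m"
    and x1: "x 1 \<in> borel_measurable M" "\<And>\<omega>. \<omega> \<in> space M \<Longrightarrow> x 1 \<omega> \<in> X"
    and fx1: "integrable M (\<lambda>\<omega>. f (x 1 \<omega>))"
    and K: "(expectation (\<lambda>\<omega>. f (x 1 \<omega>)) - flow) * L / \<epsilon>\<^sup>2 \<le> K"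
    and Z: "\<And>k i. k \<in> {1..K} \<Longrightarrow> i \<in> {1..m} \<Longrightarrow> Z k i \<in> measurable M \<Xi> \<and> distr M \<Xi> (Z k i) = distr M \<Xi> \<zeta>"
    and Y: "Y \<in> measurable M (count_space UNIV)" "\<And>\<omega>. \<omega> \<in> space M \<Longrightarrow> Y \<omega> \<in> {1..K}"
      "\<And>k. k \<in> {1..K} \<Longrightarrow> prob {\<omega> \<in> space M. Y \<omega> = k} = 1 / K"
    and indep: "indep_sets
           (\<lambda>s. case s of
              Init \<Rightarrow> sets (vimage_algebra (space M) (x 1) borel)
            | Sample k i \<Rightarrow> sets (vimage_algebra (space M) (Z k i) \<Xi>)
            | Index \<Rightarrow> sets (vimage_algebra (space M) Y (count_space UNIV)))
           ({Init, Index} \<union> {Sample k i |k i. k \<in> {1..K} \<and> i \<in> {1..m}})"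
    and step: "\<And>k \<omega>. k \<in> {1..K} \<Longrightarrow> \<omega> \<in> space M \<Longrightarrow>
      x (k + 1) \<omega> = l1_prox X (\<epsilon> / L) (x k \<omega>)
        (x k \<omega> - (1 / L) *\<^sub>R ((1 / m) *\<^sub>R (\<Sum>i=1..m. G (x k \<omega>) (Z k i \<omega>))))"
begin

abbreviation BX :: "(real ^ 'n) measure" where "BX \<equiv> restrict_space borel X"

definition E :: "source \<Rightarrow> 'w set set" where
  "E s = (case s of
      Init \<Rightarrow> sets (vimage_algebra (space M) (x 1) borel)
    | Sample k i \<Rightarrow> sets (vimage_algebra (space M) (Z k i) \<Xi>)
    | Index \<Rightarrow> sets (vimage_algebra (space M) Y (count_space UNIV)))"

definition I :: "source set" where
  "I = {Init, Index} \<union> {Sample k i |k i. k \<in> {1..K} \<and> i \<in> {1..m}}"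

lemma indep_E: "indep_sets E I"
  using indep by (simp only: E_def[abs_def] I_def)

definition hist :: "source set \<Rightarrow> 'w measure" where
  "hist J = sigma (space M) (\<Union>s\<in>J. E s)"

definition past :: "nat \<Rightarrow> nat \<Rightarrow> source set" where
  "past k j = {Init} \<union> {Sample k' i |k' i. k' \<in> {1..K} \<and> i \<in> {1..m} \<and> (k' < k \<or> k' = k \<and> i \<le> j)}"

definition noise_sum :: "nat \<Rightarrow> nat \<Rightarrow> 'w \<Rightarrow> real ^ 'n" where
  "noise_sum k j \<omega> = (\<Sum>i=1..j. G (x k \<omega>) (Z k i \<omega>) - D (x k \<omega>))"

definition noise :: "nat \<Rightarrow> 'w \<Rightarrow> real" where
  "noise k \<omega> = infnorm ((1 / m) *\<^sub>R (\<Sum>i=1..m. G (x k \<omega>) (Z k i \<omega>)) - D (x k \<omega>))"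

definition dst :: "real ^ 'n \<Rightarrow> ennreal" where
  "dst y = dist0_inf {v. v - D y \<in> normal_cone X y}"

lemma past_subset: "past k j \<subseteq> I"
  by (auto simp: past_def I_def)

lemma \<psi>_pos: "0 < \<epsilon> / L"
  using pos by simp

lemma x_in: "k \<in> {1..K + 1} \<Longrightarrow> \<omega> \<in> space M \<Longrightarrow> x k \<omega> \<in> X"
proof (induction k)
  case (Suc k)
  show ?case
  proof (cases "k = 0")
    case False
    then have "x k \<omega> \<in> X" "x (Suc k) \<omega> = l1_prox X (\<epsilon> / L) (x k \<omega>)
        (x k \<omega> - (1 / L) *\<^sub>R ((1 / m) *\<^sub>R (\<Sum>i=1..m. G (x k \<omega>) (Z k i \<omega>))))"
      using Suc step[of k \<omega>] by auto
    then show ?thesis using l1_prox_in(1)[OF closed_X convex_X \<psi>_pos] by metis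
  qed (use Suc x1 in auto)
qed simp

lemma continuous_on_D: "continuous_on X D"
proof (rule continuous_on_iff[THEN iffD2], intro ballI allI impI)
  fix y and e :: real assume y: "y \<in> X" and e: "0 < e"
  have "((\<lambda>z. sqrt DIM(real ^ 'n) * (L * l1norm (z - y))) \<longlongrightarrow> sqrt DIM(real ^ 'n) * (L * l1norm (y - y))) (at y within X)"
    unfolding l1norm_def by (intro tendsto_intros)
  then have "eventually (\<lambda>z. sqrt DIM(real ^ 'n) * (L * l1norm (z - y)) < e) (at y within X)"
    using e by (intro order_tendstoD(2)) auto
  then obtain d where d: "0 < d"
    "\<And>z. z \<in> X \<Longrightarrow> z \<noteq> y \<Longrightarrow> dist z y < d \<Longrightarrow> sqrt DIM(real ^ 'n) * (L * l1norm (z - y)) < e"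
    by (auto simp: eventually_at)
  have "dist (D z) (D y) < e" if "z \<in> X" "dist z y < d" for z
  proof (cases "z = y")
    case False
    have "norm (D z - D y) \<le> sqrt DIM(real ^ 'n) * infnorm (D z - D y)"
      by (rule norm_le_infnorm)
    also have "\<dots> \<le> sqrt DIM(real ^ 'n) * (L * l1norm (z - y))"
      using lip[OF that(1) y] by (intro mult_left_mono) auto
    also have "\<dots> < e" using d(2) that False by blast
    finally show ?thesis by (simp add: dist_norm)
  qed (use e in simp)
  then show "\<exists>d>0. \<forall>z\<in>X. dist z y < d \<longrightarrow> dist (D z) (D y) < e" using d(1) by blast
qed

lemma D_measurable [measurable]: "D \<in> measurable BX borel"
  by (rule borel_measurable_continuous_on_restrict[OF continuous_on_D])

lemma dst_measurable [measurable]: "dst \<in> borel_measurable BX"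
  unfolding dst_def by (rule dist0_inf_normal_cone_borel_measurable[OF closed_X continuous_on_D])

lemma G_measurable_comp [measurable (raw)]:
  assumes [measurable]: "a \<in> measurable N BX" "b \<in> measurable N \<Xi>"
  shows "(\<lambda>\<omega>. G (a \<omega>) (b \<omega>)) \<in> borel_measurable N"
  using measurable_compose[OF measurable_Pair[OF assms] G] by simp

lemma space_hist [simp]: "space (hist J) = space M"
  by (simp add: hist_def space_measure_of_conv)

lemma E_Pow: "E s \<subseteq> Pow (space M)"
  using sets.space_closed[of "vimage_algebra (space M) (x 1) borel"]
    sets.space_closed[of "vimage_algebra (space M) Y (count_space UNIV)"]
    sets.space_closed[of "vimage_algebra (space M) (Z _ _) \<Xi>"]
  by (cases s) (simp_all add: E_def)

lemma E_Int_stable: "Int_stable (E s)"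
  by (cases s) (simp_all add: E_def sets.Int_stable)

lemma x1_hist: "Init \<in> J \<Longrightarrow> x 1 \<in> measurable (hist J) borel"
  unfolding hist_def by (rule measurable_sigma_vimage_algebra[where s = Init, OF _ _ _ E_Pow]) (auto simp: E_def)

lemma Z_hist: "Sample k i \<in> J \<Longrightarrow> k \<in> {1..K} \<Longrightarrow> i \<in> {1..m} \<Longrightarrow> Z k i \<in> measurable (hist J) \<Xi>"
  unfolding hist_def
  by (rule measurable_sigma_vimage_algebra[where s = "Sample k i", OF _ _ _ E_Pow])
    (auto simp: E_def intro!: measurable_space[OF conjunct1[OF Z]])

lemma Y_hist: "Y \<in> measurable (hist {Index}) (count_space UNIV)"
  unfolding hist_def by (rule measurable_sigma_vimage_algebra[where s = Index, OF _ _ _ E_Pow]) (auto simp: E_def)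

lemmas nn_integral_hist =
  nn_integral_disjoint_sources[OF indep_E E_Int_stable, folded hist_def]

lemmas hist_measurable_imp = measurable_sources(1)[OF indep_E, folded hist_def]

lemma x_hist: "k \<in> {1..K + 1} \<Longrightarrow> past k 0 \<subseteq> J \<Longrightarrow> x k \<in> measurable (hist J) BX"
proof (induction k)
  case (Suc k)
  show ?case
  proof (cases "k = 0")
    case True
    have "Init \<in> J" using Suc.prems by (auto simp: past_def)
    then show ?thesis
      using True x1_hist x1 by (auto intro!: measurable_restrict_space2)
  next
    case False
    then have k: "k \<in> {1..K}" using Suc.prems by auto
    have "past k 0 \<subseteq> J" using Suc.prems(2) by (auto simp: past_def)
    then have xk [measurable]: "x k \<in> measurable (hist J) BX" using Suc.IH k by simp
    then have xk' [measurable]: "x k \<in> measurable (hist J) borel"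
      by (simp add: measurable_restrict_space2_iff)
    have Zk [measurable]: "Z k i \<in> measurable (hist J) \<Xi>" if "i \<in> {1..m}" for i
      using Suc.prems(2) k that by (intro Z_hist) (auto simp: past_def)
    define u where "u \<omega> = x k \<omega> - (1 / L) *\<^sub>R ((1 / m) *\<^sub>R (\<Sum>i=1..m. G (x k \<omega>) (Z k i \<omega>)))" for \<omega>
    have [measurable]: "u \<in> borel_measurable (hist J)"
      unfolding u_def by measurable
    have "(\<lambda>\<omega>. (x k \<omega>, u \<omega>)) \<in> measurable (hist J) (restrict_space borel (X \<times> UNIV))"
      using x_in k by (intro measurable_restrict_space2 borel_measurable_Pair) auto
    from measurable_compose[OF this borel_measurable_continuous_on_restrict[OF
          continuous_on_l1_prox[OF closed_X convex_X \<psi>_pos]]]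
    have "(\<lambda>\<omega>. l1_prox X (\<epsilon> / L) (x k \<omega>) (u \<omega>)) \<in> borel_measurable (hist J)" by simp
    then have "x (Suc k) \<in> borel_measurable (hist J)"
      using step[OF k] by (subst measurable_cong) (auto simp: u_def)
    then show ?thesis
      using x_in[OF Suc.prems(1)] by (intro measurable_restrict_space2) auto
  qed
qed simp

lemma noise_sum_hist:
  assumes k: "k \<in> {1..K}" and j: "j \<le> m" and J: "past k j \<subseteq> J"
  shows "noise_sum k j \<in> borel_measurable (hist J)"
proof -
  have [measurable]: "x k \<in> measurable (hist J) BX"
    using k J by (intro x_hist) (auto simp: past_def)
  have [measurable]: "Z k i \<in> measurable (hist J) \<Xi>" if "i \<in> {1..j}" for i
    using J k j that by (intro Z_hist) (auto simp: past_def)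
  show ?thesis unfolding noise_sum_def by measurable
qed

lemma x_rv: "k \<in> {1..K + 1} \<Longrightarrow> x k \<in> measurable M BX"
  by (rule hist_measurable_imp[OF past_subset x_hist]) auto

lemma noise_sum_rv: "k \<in> {1..K} \<Longrightarrow> j \<le> m \<Longrightarrow> noise_sum k j \<in> borel_measurable M"
  by (rule hist_measurable_imp[OF past_subset noise_sum_hist]) auto

lemma sample_moments:
  assumes y: "y \<in> X"
  defines "P \<equiv> distr M \<Xi> \<zeta>" and "W \<equiv> \<lambda>z. G y z - D y"
  shows "integrable P W" "(LINT z|P. W z) = 0" "integrable P (\<lambda>z. (infnorm (W z))\<^sup>2)"
    "(LINT z|P. (infnorm (W z))\<^sup>2) \<le> \<sigma>\<^sup>2"
proof -
  have "(\<lambda>_. y) \<in> measurable \<Xi> BX"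
    using y by (intro measurable_const) (simp add: space_restrict_space)
  then have W [measurable]: "W \<in> borel_measurable \<Xi>"
    unfolding W_def by (intro borel_measurable_diff G_measurable_comp) auto
  note \<zeta>[measurable]
  have "integrable M (\<lambda>\<omega>. W (\<zeta> \<omega>))" and "expectation (\<lambda>\<omega>. W (\<zeta> \<omega>)) = 0"
    and "integrable M (\<lambda>\<omega>. (infnorm (W (\<zeta> \<omega>)))\<^sup>2)"
    and "expectation (\<lambda>\<omega>. (infnorm (W (\<zeta> \<omega>)))\<^sup>2) \<le> \<sigma>\<^sup>2"
    using y G_int G_mean var_int var_le by (simp_all add: W_def prob_space)
  then show "integrable P W" "(LINT z|P. W z) = 0" "integrable P (\<lambda>z. (infnorm (W z))\<^sup>2)"
    "(LINT z|P. (infnorm (W z))\<^sup>2) \<le> \<sigma>\<^sup>2"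
    unfolding P_def by (simp_all add: integrable_distr_eq integral_distr)
qed

lemma nn_integral_smax_noise_sum:
  assumes k: "k \<in> {1..K}"
  shows "j \<le> m \<Longrightarrow> (\<integral>\<^sup>+\<omega>. ennreal (smax (\<beta> *\<^sub>R noise_sum k j \<omega>)) \<partial>M)
    \<le> ennreal (ln (2 * real CARD('n)) + j * (\<beta>\<^sup>2 * \<sigma>\<^sup>2 / 2))"
proof (induction j)
  case 0
  then show ?case by (simp add: noise_sum_def smax_0 emeasure_space_1)
next
  case (Suc j)
  let ?P = "distr M \<Xi> \<zeta>"
  have j: "j \<le> m" "Suc j \<in> {1..m}" using Suc.prems by auto
  interpret P: prob_space ?P by (rule prob_space_distr) (rule \<zeta>)
  define h where "h = (\<lambda>((y, s), z). ennreal (smax (\<beta> *\<^sub>R s + \<beta> *\<^sub>R (G y z - D y))))"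
  have h: "h \<in> borel_measurable ((BX \<Otimes>\<^sub>M borel) \<Otimes>\<^sub>M \<Xi>)"
    unfolding h_def case_prod_unfold by measurable
  have sum_Suc: "noise_sum k (Suc j) \<omega> = noise_sum k j \<omega> + (G (x k \<omega>) (Z k (Suc j) \<omega>) - D (x k \<omega>))" for \<omega>
    by (simp add: noise_sum_def)
  have "(\<integral>\<^sup>+\<omega>. h ((x k \<omega>, noise_sum k j \<omega>), Z k (Suc j) \<omega>) \<partial>M) =
      (\<integral>\<^sup>+\<omega>. (\<integral>\<^sup>+z. h ((x k \<omega>, noise_sum k j \<omega>), z) \<partial>distr M \<Xi> (Z k (Suc j))) \<partial>M)"
  proof (rule nn_integral_hist[OF _ _ _ _ _ h])
    show "(\<lambda>\<omega>. (x k \<omega>, noise_sum k j \<omega>)) \<in> measurable (hist (past k j)) (BX \<Otimes>\<^sub>M borel)"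
      using k j by (intro measurable_Pair x_hist noise_sum_hist) (auto simp: past_def)
    show "Z k (Suc j) \<in> measurable (hist {Sample k (Suc j)}) \<Xi>"
      using k j by (intro Z_hist) auto
  qed (use k j in \<open>auto simp: past_def I_def\<close>)
  then
  have "(\<integral>\<^sup>+\<omega>. ennreal (smax (\<beta> *\<^sub>R noise_sum k (Suc j) \<omega>)) \<partial>M) =
      (\<integral>\<^sup>+\<omega>. (\<integral>\<^sup>+z. h ((x k \<omega>, noise_sum k j \<omega>), z) \<partial>?P) \<partial>M)"
    using Z[OF k j(2)] by (simp add: h_def sum_Suc scaleR_add_right)
  also have "\<dots> \<le> (\<integral>\<^sup>+\<omega>. ennreal (smax (\<beta> *\<^sub>R noise_sum k j \<omega>)) + ennreal (\<beta>\<^sup>2 * \<sigma>\<^sup>2 / 2) \<partial>M)"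
  proof (rule nn_integral_mono)
    fix \<omega> assume "\<omega> \<in> space M"
    then have "x k \<omega> \<in> X" using x_in k by simp
    from P.nn_integral_smax_add_le[OF sample_moments[OF this]]
    show "(\<integral>\<^sup>+z. h ((x k \<omega>, noise_sum k j \<omega>), z) \<partial>?P)
        \<le> ennreal (smax (\<beta> *\<^sub>R noise_sum k j \<omega>)) + ennreal (\<beta>\<^sup>2 * \<sigma>\<^sup>2 / 2)"
      by (simp add: h_def smax_nonneg flip: ennreal_plus)
  qed
  also have "\<dots> = (\<integral>\<^sup>+\<omega>. ennreal (smax (\<beta> *\<^sub>R noise_sum k j \<omega>)) \<partial>M) + ennreal (\<beta>\<^sup>2 * \<sigma>\<^sup>2 / 2)"
  proof -
    have [measurable]: "noise_sum k j \<in> borel_measurable M" using noise_sum_rv k j by simp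
    show ?thesis by (subst nn_integral_add) (auto simp: emeasure_space_1)
  qed
  also have "\<dots> \<le> ennreal (ln (2 * real CARD('n)) + j * (\<beta>\<^sup>2 * \<sigma>\<^sup>2 / 2)) + ennreal (\<beta>\<^sup>2 * \<sigma>\<^sup>2 / 2)"
    by (intro add_mono Suc.IH j order_refl)
  also have "\<dots> = ennreal (ln (2 * real CARD('n)) + j * (\<beta>\<^sup>2 * \<sigma>\<^sup>2 / 2) + \<beta>\<^sup>2 * \<sigma>\<^sup>2 / 2)"
    using dim by (intro ennreal_plus[symmetric]) (auto intro!: add_nonneg_nonneg)
  also have "ln (2 * real CARD('n)) + j * (\<beta>\<^sup>2 * \<sigma>\<^sup>2 / 2) + \<beta>\<^sup>2 * \<sigma>\<^sup>2 / 2 =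
      ln (2 * real CARD('n)) + Suc j * (\<beta>\<^sup>2 * \<sigma>\<^sup>2 / 2)"
    by (simp add: algebra_simps)
  finally show ?case .
qed

lemma noise_eq: "noise k \<omega> = infnorm (noise_sum k m \<omega>) / m"
proof -
  have "(1 / m) *\<^sub>R (\<Sum>i=1..m. G (x k \<omega>) (Z k i \<omega>)) - D (x k \<omega>) = (1 / m) *\<^sub>R noise_sum k m \<omega>"
    using pos by (simp add: noise_sum_def sum_subtractf scaleR_diff_right sum_constant_scaleR
      del: sum_constant)
  then show ?thesis by (simp add: noise_def infnorm_mul)
qed

lemma noise_rv: "k \<in> {1..K} \<Longrightarrow> noise k \<in> borel_measurable M"
  using noise_sum_rv[of k m] unfolding noise_eq[abs_def] by measurable

lemma noise_le:
  assumes k: "k \<in> {1..K}"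
  shows "(\<integral>\<^sup>+\<omega>. ennreal (noise k \<omega>) \<partial>M) \<le> ennreal \<epsilon>"
proof -
  define \<beta> where "\<beta> = \<epsilon> / \<sigma>\<^sup>2"
  define l where "l = ln (real CARD('n))"
  have \<beta>: "0 < \<beta>" using pos by (simp add: \<beta>_def)
  have "ln 2 \<le> l" unfolding l_def using dim by simp
  then have ln2d: "ln (2 * real CARD('n)) \<le> 2 * l" and l: "0 \<le> l"
    using dim ln_gt_zero[of 2] by (auto simp: ln_mult l_def)
  have "(2::real) ^ 2 \<le> exp 1 ^ 2"
    using exp_ge_add_one_self[of 1] by (intro power_mono) auto
  then have "4 * (l * \<sigma>\<^sup>2 / \<epsilon>\<^sup>2) \<le> exp 1 ^ 2 * (l * \<sigma>\<^sup>2 / \<epsilon>\<^sup>2)"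
    using l by (intro mult_right_mono) auto
  also have "\<dots> \<le> m" using m by (simp add: l_def mult.assoc)
  finally have m4: "4 * l * \<sigma>\<^sup>2 \<le> m * \<epsilon>\<^sup>2" using pos by (simp add: field_simps)
  have meas [measurable]: "noise_sum k m \<in> borel_measurable M" using noise_sum_rv k by simp
  have "ennreal (noise k \<omega>) \<le> ennreal (1 / (m * \<beta>)) * ennreal (smax (\<beta> *\<^sub>R noise_sum k m \<omega>))" for \<omega>
  proof -
    have "noise k \<omega> = 1 / (m * \<beta>) * infnorm (\<beta> *\<^sub>R noise_sum k m \<omega>)"
      using \<beta> pos by (simp add: noise_eq infnorm_mul)
    also have "\<dots> \<le> 1 / (m * \<beta>) * smax (\<beta> *\<^sub>R noise_sum k m \<omega>)"
      using \<beta> by (intro mult_left_mono infnorm_le_smax) auto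
    finally show ?thesis
      using \<beta> by (subst ennreal_mult[symmetric]) (auto intro: ennreal_leI smax_nonneg)
  qed
  then have "(\<integral>\<^sup>+\<omega>. ennreal (noise k \<omega>) \<partial>M) \<le>
      (\<integral>\<^sup>+\<omega>. ennreal (1 / (m * \<beta>)) * ennreal (smax (\<beta> *\<^sub>R noise_sum k m \<omega>)) \<partial>M)"
    by (intro nn_integral_mono)
  also have "\<dots> = ennreal (1 / (m * \<beta>)) * (\<integral>\<^sup>+\<omega>. ennreal (smax (\<beta> *\<^sub>R noise_sum k m \<omega>)) \<partial>M)"
    by (intro nn_integral_cmult) measurable
  also have "\<dots> \<le> ennreal (1 / (m * \<beta>)) * ennreal (ln (2 * real CARD('n)) + m * (\<beta>\<^sup>2 * \<sigma>\<^sup>2 / 2))"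
    by (intro mult_left_mono nn_integral_smax_noise_sum k) auto
  also have "\<dots> = ennreal (1 / (m * \<beta>) * (ln (2 * real CARD('n)) + m * (\<beta>\<^sup>2 * \<sigma>\<^sup>2 / 2)))"
    using \<beta> dim by (intro ennreal_mult[symmetric]) (auto intro!: add_nonneg_nonneg)
  also have "1 / (m * \<beta>) * (ln (2 * real CARD('n)) + m * (\<beta>\<^sup>2 * \<sigma>\<^sup>2 / 2))
      \<le> 1 / (m * \<beta>) * (2 * l + m * (\<beta>\<^sup>2 * \<sigma>\<^sup>2 / 2))"
    using ln2d \<beta> by (intro mult_left_mono) auto
  also have "\<dots> = 2 * l * \<sigma>\<^sup>2 / (m * \<epsilon>) + \<epsilon> / 2"
    using pos by (simp add: \<beta>_def field_simps power2_eq_square)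
  also have "2 * l * \<sigma>\<^sup>2 / (m * \<epsilon>) \<le> \<epsilon> / 2"
    using m4 pos by (simp add: field_simps power2_eq_square)
  finally show ?thesis by (simp add: ennreal_leI)
qed

lemma sum_dst_le:
  assumes \<omega>: "\<omega> \<in> space M"
  shows "(\<Sum>k=1..K. dst (x (k + 1) \<omega>)) \<le>
    ennreal (5 / 2 * \<epsilon> * K) + 2 * (\<Sum>k=1..K. ennreal (noise k \<omega>)) + ennreal (L / \<epsilon> * (f (x 1 \<omega>) - flow))"
proof -
  have "\<forall>k\<in>{1..K}. \<exists>v. v - D (x (k + 1) \<omega>) \<in> normal_cone X (x (k + 1) \<omega>) \<and>
      infnorm v \<le> 5 / 2 * \<epsilon> + 2 * noise k \<omega> + L / \<epsilon> * (f (x k \<omega>) - f (x (k + 1) \<omega>))"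
  proof
    fix k assume k: "k \<in> {1..K}"
    then have "x k \<omega> \<in> X" using x_in \<omega> by simp
    from l1_prox_step_dist[OF closed_X convex_X this D lip pos(2,3)]
    show "\<exists>v. v - D (x (k + 1) \<omega>) \<in> normal_cone X (x (k + 1) \<omega>) \<and>
        infnorm v \<le> 5 / 2 * \<epsilon> + 2 * noise k \<omega> + L / \<epsilon> * (f (x k \<omega>) - f (x (k + 1) \<omega>))"
      unfolding step[OF k \<omega>] noise_def .
  qed
  then obtain v where v: "\<And>k. k \<in> {1..K} \<Longrightarrow> v k - D (x (k + 1) \<omega>) \<in> normal_cone X (x (k + 1) \<omega>)"
    "\<And>k. k \<in> {1..K} \<Longrightarrow> infnorm (v k) \<le> 5 / 2 * \<epsilon> + 2 * noise k \<omega> + L / \<epsilon> * (f (x k \<omega>) - f (x (k + 1) \<omega>))"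
    by metis
  have noise0: "0 \<le> noise k \<omega>" for k by (simp add: noise_def infnorm_pos_le)
  have fl: "flow \<le> f (x 1 \<omega>)" using flow x_in \<omega> by simp
  have "(\<Sum>k=1..K. dst (x (k + 1) \<omega>)) \<le> (\<Sum>k=1..K. ennreal (infnorm (v k)))"
    unfolding dst_def dist0_inf_def using v(1) by (intro sum_mono INF_lower) simp
  also have "\<dots> = ennreal (\<Sum>k=1..K. infnorm (v k))"
    by (intro sum_ennreal) (auto simp: infnorm_pos_le)
  finally have le: "(\<Sum>k=1..K. dst (x (k + 1) \<omega>)) \<le> ennreal (\<Sum>k=1..K. infnorm (v k))" .
  define S where "S = (\<Sum>k=1..K. noise k \<omega>)"
  have S: "0 \<le> S" "(\<Sum>k=1..K. ennreal (noise k \<omega>)) = ennreal S"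
    using noise0 by (auto simp: S_def sum_nonneg)
  have "(\<Sum>k=1..K. infnorm (v k)) \<le>
      (\<Sum>k=1..K. 5 / 2 * \<epsilon> + 2 * noise k \<omega> + L / \<epsilon> * (f (x k \<omega>) - f (x (k + 1) \<omega>)))"
    by (intro sum_mono v(2))
  also have "\<dots> = 5 / 2 * \<epsilon> * K + 2 * S + L / \<epsilon> * (\<Sum>k=1..K. f (x k \<omega>) - f (x (Suc k) \<omega>))"
    by (simp add: S_def sum.distrib flip: sum_distrib_left sum_divide_distrib)
  also have "(\<Sum>k=1..K. f (x k \<omega>) - f (x (Suc k) \<omega>)) = f (x 1 \<omega>) - f (x (K + 1) \<omega>)"
    using sum_Suc_diff[of 1 K "\<lambda>k. - f (x k \<omega>)"] pos by simp
  also have "5 / 2 * \<epsilon> * K + 2 * S + L / \<epsilon> * (f (x 1 \<omega>) - f (x (K + 1) \<omega>)) \<le>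
      5 / 2 * \<epsilon> * K + 2 * S + L / \<epsilon> * (f (x 1 \<omega>) - flow)"
    using flow[OF x_in[OF _ \<omega>, of "K + 1"]] pos by (intro add_left_mono mult_left_mono) auto
  finally have "ennreal (\<Sum>k=1..K. infnorm (v k)) \<le>
      ennreal (5 / 2 * \<epsilon> * K + 2 * S + L / \<epsilon> * (f (x 1 \<omega>) - flow))"
    by (rule ennreal_leI)
  also have "\<dots> = ennreal (5 / 2 * \<epsilon> * K) + 2 * ennreal S + ennreal (L / \<epsilon> * (f (x 1 \<omega>) - flow))"
    using pos S(1) fl by (simp add: ennreal_mult)
  finally show ?thesis using le S(2) by simp
qed

lemma nn_integral_sum_dst_le: "(\<integral>\<^sup>+\<omega>. (\<Sum>k=1..K. dst (x (k + 1) \<omega>)) \<partial>M) \<le> ennreal (K * (11 / 2 * \<epsilon>))"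
proof -
  have [measurable]: "noise k \<in> borel_measurable M" if "k \<in> {1..K}" for k
    using that by (rule noise_rv)
  have fl: "flow \<le> f (x 1 \<omega>)" if "\<omega> \<in> space M" for \<omega> using flow x_in that by simp
  have [measurable]: "(\<lambda>\<omega>. f (x 1 \<omega>)) \<in> borel_measurable M" using fx1 by simp
  have "(\<integral>\<^sup>+\<omega>. (\<Sum>k=1..K. dst (x (k + 1) \<omega>)) \<partial>M) \<le> (\<integral>\<^sup>+\<omega>. ennreal (5 / 2 * \<epsilon> * K) +
      2 * (\<Sum>k=1..K. ennreal (noise k \<omega>)) + ennreal (L / \<epsilon> * (f (x 1 \<omega>) - flow)) \<partial>M)"
    by (intro nn_integral_mono sum_dst_le)
  also have "\<dots> = ennreal (5 / 2 * \<epsilon> * K) + 2 * (\<Sum>k=1..K. \<integral>\<^sup>+\<omega>. ennreal (noise k \<omega>) \<partial>M) +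
      (\<integral>\<^sup>+\<omega>. ennreal (L / \<epsilon> * (f (x 1 \<omega>) - flow)) \<partial>M)"
  proof -
    define s where "s \<omega> = (\<Sum>k=1..K. ennreal (noise k \<omega>))" for \<omega>
    define u where "u \<omega> = ennreal (L / \<epsilon> * (f (x 1 \<omega>) - flow))" for \<omega>
    have [measurable]: "s \<in> borel_measurable M" "u \<in> borel_measurable M"
      unfolding s_def u_def by measurable
    have "(\<integral>\<^sup>+\<omega>. s \<omega> \<partial>M) = (\<Sum>k=1..K. \<integral>\<^sup>+\<omega>. ennreal (noise k \<omega>) \<partial>M)"
      unfolding s_def by (intro nn_integral_sum) measurable
    moreover have "(\<integral>\<^sup>+\<omega>. c + 2 * s \<omega> + u \<omega> \<partial>M) = c + 2 * (\<integral>\<^sup>+\<omega>. s \<omega> \<partial>M) + (\<integral>\<^sup>+\<omega>. u \<omega> \<partial>M)" for c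
      by (simp add: nn_integral_add nn_integral_cmult emeasure_space_1)
    ultimately show ?thesis by (simp only: s_def u_def)
  qed
  also have "(\<integral>\<^sup>+\<omega>. ennreal (L / \<epsilon> * (f (x 1 \<omega>) - flow)) \<partial>M) =
      ennreal (L / \<epsilon> * (expectation (\<lambda>\<omega>. f (x 1 \<omega>)) - flow))"
    using fx1 fl pos by (subst nn_integral_eq_integral) (auto simp: prob_space)
  also have "ennreal (5 / 2 * \<epsilon> * K) + 2 * (\<Sum>k=1..K. \<integral>\<^sup>+\<omega>. ennreal (noise k \<omega>) \<partial>M) +
      ennreal (L / \<epsilon> * (expectation (\<lambda>\<omega>. f (x 1 \<omega>)) - flow)) \<le>
      ennreal (5 / 2 * \<epsilon> * K) + 2 * (\<Sum>k=1..K. ennreal \<epsilon>) + ennreal (K * \<epsilon>)"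
  proof (intro add_mono mult_left_mono sum_mono noise_le ennreal_leI order_refl)
    show "L / \<epsilon> * (expectation (\<lambda>\<omega>. f (x 1 \<omega>)) - flow) \<le> K * \<epsilon>"
      using K pos by (simp add: field_simps power2_eq_square)
  qed (use pos in auto)
  also have "(\<Sum>k=1..K. ennreal \<epsilon>) = ennreal (K * \<epsilon>)"
    using pos by (simp add: ennreal_mult ennreal_of_nat_eq_real_of_nat)
  also have "ennreal (5 / 2 * \<epsilon> * K) + 2 * ennreal (K * \<epsilon>) + ennreal (K * \<epsilon>) =
      ennreal (5 / 2 * \<epsilon> * K + 2 * (K * \<epsilon>) + K * \<epsilon>)"
  proof -
    have "ennreal a + 2 * ennreal b + ennreal c = ennreal (a + 2 * b + c)"
      if "0 \<le> a" "0 \<le> b" "0 \<le> c" for a b c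
      using that by (simp add: ennreal_mult)
    then show ?thesis using pos by (simp only: mult_nonneg_nonneg of_nat_0_le_iff zero_le_divide_iff
          less_imp_le zero_le_numeral)
  qed
  also have "5 / 2 * \<epsilon> * K + 2 * (K * \<epsilon>) + K * \<epsilon> = K * (11 / 2 * \<epsilon>)" by simp
  finally show ?thesis .
qed

lemma dst_output_eq:
  "\<omega> \<in> space M \<Longrightarrow> dst (x (Y \<omega> + 1) \<omega>) = (\<Sum>k=1..K. dst (x (k + 1) \<omega>) * indicator {k} (Y \<omega>))"
  using Y(2)[of \<omega>] by (simp add: sum.delta indicator_def if_distrib cong: if_cong)

lemma dst_output_term_rv:
  assumes "k \<in> {1..K}"
  shows "(\<lambda>\<omega>. dst (x (k + 1) \<omega>) * indicator {k} (Y \<omega>)) \<in> borel_measurable M"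
proof -
  have [measurable]: "x (k + 1) \<in> measurable M BX" using assms by (intro x_rv) auto
  have [measurable]: "(\<lambda>\<omega>. indicator {k} (Y \<omega>) :: ennreal) \<in> borel_measurable M"
    by (rule measurable_compose[OF Y(1)]) simp
  show ?thesis by measurable
qed

lemma dst_output_rv: "(\<lambda>\<omega>. dst (x (Y \<omega> + 1) \<omega>)) \<in> borel_measurable M"
  by (subst measurable_cong[OF dst_output_eq]) (assumption | intro borel_measurable_sum dst_output_term_rv)+

lemma nn_integral_dst_output: "(\<integral>\<^sup>+\<omega>. dst (x (Y \<omega> + 1) \<omega>) \<partial>M) \<le> ennreal (11 / 2 * \<epsilon>)"
proof -
  have "(\<integral>\<^sup>+\<omega>. dst (x (k + 1) \<omega>) * indicator {k} (Y \<omega>) \<partial>M) =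
      (\<integral>\<^sup>+\<omega>. dst (x (k + 1) \<omega>) \<partial>M) * ennreal (1 / K)" if k: "k \<in> {1..K}" for k
  proof -
    have [measurable]: "x (k + 1) \<in> measurable M BX" using k by (intro x_rv) auto
    define h where "h = (\<lambda>(y, n). dst y * indicator {k} n)"
    have h: "h \<in> borel_measurable (BX \<Otimes>\<^sub>M count_space UNIV)"
    proof -
      have [measurable]: "(\<lambda>p. indicator {k} (snd p) :: ennreal) \<in> borel_measurable (BX \<Otimes>\<^sub>M count_space UNIV)"
        by (rule measurable_compose[OF measurable_snd]) simp
      show ?thesis unfolding h_def case_prod_unfold by measurable
    qed
    have "(\<integral>\<^sup>+\<omega>. h (x (k + 1) \<omega>, Y \<omega>) \<partial>M) =
        (\<integral>\<^sup>+\<omega>. (\<integral>\<^sup>+n. h (x (k + 1) \<omega>, n) \<partial>distr M (count_space UNIV) Y) \<partial>M)"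
      by (rule nn_integral_hist[OF past_subset[of "k + 1" 0] _ _ x_hist Y_hist h])
        (use k in \<open>auto simp: past_def I_def\<close>)
    then have "(\<integral>\<^sup>+\<omega>. dst (x (k + 1) \<omega>) * indicator {k} (Y \<omega>) \<partial>M) =
        (\<integral>\<^sup>+\<omega>. dst (x (k + 1) \<omega>) * emeasure (distr M (count_space UNIV) Y) {k} \<partial>M)"
      by (simp add: h_def nn_integral_cmult)
    also have "emeasure (distr M (count_space UNIV) Y) {k} = emeasure M {\<omega> \<in> space M. Y \<omega> = k}"
      using Y(1) by (subst emeasure_distr) (auto intro!: arg_cong[where f = "emeasure M"])
    also have "\<dots> = ennreal (1 / K)"
      using Y(3)[OF k] by (simp add: emeasure_eq_measure)
    also have "(\<integral>\<^sup>+\<omega>. dst (x (k + 1) \<omega>) * ennreal (1 / K) \<partial>M) =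
        (\<integral>\<^sup>+\<omega>. dst (x (k + 1) \<omega>) \<partial>M) * ennreal (1 / K)"
      by (intro nn_integral_multc) measurable
    finally show ?thesis .
  qed
  note split = this
  have "(\<integral>\<^sup>+\<omega>. dst (x (Y \<omega> + 1) \<omega>) \<partial>M) =
      (\<integral>\<^sup>+\<omega>. (\<Sum>k=1..K. dst (x (k + 1) \<omega>) * indicator {k} (Y \<omega>)) \<partial>M)"
    by (intro nn_integral_cong dst_output_eq)
  also have "\<dots> = (\<Sum>k=1..K. \<integral>\<^sup>+\<omega>. dst (x (k + 1) \<omega>) * indicator {k} (Y \<omega>) \<partial>M)"
    by (intro nn_integral_sum dst_output_term_rv)
  also have "\<dots> = (\<Sum>k=1..K. (\<integral>\<^sup>+\<omega>. dst (x (k + 1) \<omega>) \<partial>M) * ennreal (1 / K))"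
    by (intro sum.cong refl split)
  also have "\<dots> = (\<integral>\<^sup>+\<omega>. (\<Sum>k=1..K. dst (x (k + 1) \<omega>)) \<partial>M) * ennreal (1 / K)"
    using measurable_compose[OF x_rv dst_measurable]
    by (subst nn_integral_sum) (simp_all add: sum_distrib_right)
  also have "\<dots> \<le> ennreal (K * (11 / 2 * \<epsilon>)) * ennreal (1 / K)"
    by (intro mult_right_mono nn_integral_sum_dst_le) auto
  also have "\<dots> = ennreal (11 / 2 * \<epsilon>)"
    using pos by (subst ennreal_mult[symmetric]) auto
  finally show ?thesis .
qed

end

theorem corollary4:
  fixes M :: "'w measure" and \<Xi> :: "'z measure"
    and X :: "(real ^ 'n) set"
    and f :: "real ^ 'n \<Rightarrow> real" and F :: "real ^ 'n \<Rightarrow> 'z \<Rightarrow> real"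
    and G :: "real ^ 'n \<Rightarrow> 'z \<Rightarrow> real ^ 'n"
    and \<zeta> :: "'w \<Rightarrow> 'z"
    and Z :: "nat \<Rightarrow> nat \<Rightarrow> 'w \<Rightarrow> 'z"
    and x :: "nat \<Rightarrow> 'w \<Rightarrow> real ^ 'n"
    and g :: "nat \<Rightarrow> 'w \<Rightarrow> real ^ 'n"
    and Y :: "'w \<Rightarrow> nat"
    and \<phi> :: "real ^ 'n \<Rightarrow> ereal"
    and \<sigma> L flow \<Delta> \<epsilon> \<psi> :: real
    and \<eta> p :: "nat \<Rightarrow> real" and mk :: "nat \<Rightarrow> nat" and K m :: nat
  (* problem and oracle *)
  assumes "prob_space M"
    and "CARD('n) \<ge> 2"
    and "X \<noteq> {}" and "closed X" and "convex X"
    and "\<zeta> \<in> measurable M \<Xi>"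
    and "\<And>y. integrable M (\<lambda>\<omega>. F y (\<zeta> \<omega>))"
    and "\<And>y. f y = prob_space.expectation M (\<lambda>\<omega>. F y (\<zeta> \<omega>))"
    and "\<And>y. f differentiable (at y)"
    and "(\<lambda>(y, z). G y z) \<in> borel_measurable (restrict_space borel X \<Otimes>\<^sub>M \<Xi>)"
    and "\<And>y. y \<in> X \<Longrightarrow> integrable M (\<lambda>\<omega>. G y (\<zeta> \<omega>))"
    and "\<And>y. y \<in> X \<Longrightarrow> prob_space.expectation M (\<lambda>\<omega>. G y (\<zeta> \<omega>)) = grad f y"
  (* standing assumptions; sigma^2 is the maximum of the variances *)
    and "\<And>y. y \<in> X \<Longrightarrow> integrable M (\<lambda>\<omega>. (infnorm (G y (\<zeta> \<omega>) - grad f y))\<^sup>2)"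
    and "\<And>y. y \<in> X \<Longrightarrow>
           prob_space.expectation M (\<lambda>\<omega>. (infnorm (G y (\<zeta> \<omega>) - grad f y))\<^sup>2) \<le> \<sigma>\<^sup>2"
    and "\<exists>y\<in>X. prob_space.expectation M (\<lambda>\<omega>. (infnorm (G y (\<zeta> \<omega>) - grad f y))\<^sup>2) = \<sigma>\<^sup>2"
    and "\<sigma> > 0"
    and "L > 0"
    and "\<And>y z. y \<in> X \<Longrightarrow> z \<in> X \<Longrightarrow> infnorm (grad f y - grad f z) \<le> L * l1norm (y - z)"
    and "\<And>y. y \<in> X \<Longrightarrow> flow \<le> f y"
    and "x 1 \<in> borel_measurable M" and "\<And>\<omega>. \<omega> \<in> space M \<Longrightarrow> x 1 \<omega> \<in> X"
    and "integrable M (\<lambda>\<omega>. f (x 1 \<omega>))"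
    and "\<Delta> = prob_space.expectation M (\<lambda>\<omega>. f (x 1 \<omega>)) - flow"
    and "\<Delta> > 0"
  (* parameters *)
    and "\<epsilon> > 0"
    and "\<And>k. k \<in> {1..K} \<Longrightarrow> \<eta> k = 1 / L"
    and "K = nat \<lceil>\<Delta> * L / \<epsilon>\<^sup>2\<rceil>"
    and "m = nat \<lceil>exp 1 ^ 2 * ln (real CARD('n)) * \<sigma>\<^sup>2 / \<epsilon>\<^sup>2\<rceil>"
    and "\<And>k. k \<in> {1..K} \<Longrightarrow> mk k = m"
    and "\<psi> = \<epsilon> / L"
    and "\<And>k. k \<in> {1..K} \<Longrightarrow> p k = 1 / real K"
    and "\<phi> = set_indicator {z. l1norm z \<le> \<psi>}"
  (* randomness *)
    and "\<And>k i. k \<in> {1..K} \<Longrightarrow> i \<in> {1..mk k} \<Longrightarrow>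
           Z k i \<in> measurable M \<Xi> \<and> distr M \<Xi> (Z k i) = distr M \<Xi> \<zeta>"
    and "Y \<in> measurable M (count_space UNIV)"
    and "\<And>\<omega>. \<omega> \<in> space M \<Longrightarrow> Y \<omega> \<in> {1..K}"
    and "\<And>k. k \<in> {1..K} \<Longrightarrow> measure M {\<omega> \<in> space M. Y \<omega> = k} = p k"
    and "prob_space.indep_sets M
           (\<lambda>s. case s of
              Init \<Rightarrow> sets (vimage_algebra (space M) (x 1) borel)
            | Sample k i \<Rightarrow> sets (vimage_algebra (space M) (Z k i) \<Xi>)
            | Index \<Rightarrow> sets (vimage_algebra (space M) Y (count_space UNIV)))
           ({Init, Index} \<union> {Sample k i |k i. k \<in> {1..K} \<and> i \<in> {1..mk k}})"
  (* algorithm *)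
    and "\<And>k \<omega>. k \<in> {1..K} \<Longrightarrow> \<omega> \<in> space M \<Longrightarrow>
           g k \<omega> = (1 / real (mk k)) *\<^sub>R (\<Sum>i=1..mk k. G (x k \<omega>) (Z k i \<omega>))"
    and "\<And>k \<omega>. k \<in> {1..K} \<Longrightarrow> \<omega> \<in> space M \<Longrightarrow>
           is_arg_min
             (\<lambda>y. ereal (1 / 2 * (norm (y - (x k \<omega> - \<eta> k *\<^sub>R g k \<omega>)))\<^sup>2) + \<phi> (y - x k \<omega>))
             (\<lambda>y. y \<in> X) (x (k + 1) \<omega>)"
  shows
    "((\<lambda>\<omega>. dist0_inf (frechet_subdiff (\<lambda>y. ereal (f y) + set_indicator X y) (x (Y \<omega> + 1) \<omega>)))
        \<in> borel_measurable M
      \<and> (\<integral>\<^sup>+ \<omega>. dist0_inf (frechet_subdiff (\<lambda>y. ereal (f y) + set_indicator X y)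
                          (x (Y \<omega> + 1) \<omega>)) \<partial>M) \<le> ennreal (C1 * \<epsilon>))
     \<and> (\<Sum>k=1..K. mk k) = K * m
     \<and> (\<Delta> * L / \<epsilon>\<^sup>2 \<ge> 1 \<longrightarrow>
        exp 1 ^ 2 * ln (real CARD('n)) * \<sigma>\<^sup>2 / \<epsilon>\<^sup>2 \<ge> 1 \<longrightarrow>
        real (K * m) \<le> C2 * (\<Delta> * L * ln (real CARD('n)) * \<sigma>\<^sup>2 / \<epsilon> ^ 4))"
proof -
  interpret prob_space M by fact
  have e2: "0 < exp 1 ^ 2 * ln (real CARD('n)) * \<sigma>\<^sup>2 / \<epsilon>\<^sup>2"
    using assms(2,16,25) by simp
  have a: "0 < \<Delta> * L / \<epsilon>\<^sup>2" using assms(17,24,25) by simp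
  have Kpos: "0 < K" and mpos: "0 < m"
    using a e2 unfolding assms(27,28) by linarith+
  have K_bounds: "\<Delta> * L / \<epsilon>\<^sup>2 \<le> K" "K \<le> \<Delta> * L / \<epsilon>\<^sup>2 + 1"
    and m_bounds: "exp 1 ^ 2 * ln (real CARD('n)) * \<sigma>\<^sup>2 / \<epsilon>\<^sup>2 \<le> m"
      "m \<le> exp 1 ^ 2 * ln (real CARD('n)) * \<sigma>\<^sup>2 / \<epsilon>\<^sup>2 + 1"
    using a e2 unfolding assms(27,28) by linarith+
  have mk: "mk k = m" if "k \<in> {1..K}" for k using assms(29) that .
  have \<psi>: "0 < \<psi>" using assms(17,25,30) by simp
  have xX: "x k \<omega> \<in> X" if "k \<in> {1..K + 1}" "\<omega> \<in> space M" for k \<omega>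
  proof (cases "k = 1")
    case False
    then have "k - 1 \<in> {1..K}" "k - 1 + 1 = k" using that(1) by auto
    then show ?thesis using assms(39)[of "k - 1" \<omega>] that(2) by (simp add: is_arg_min_def)
  qed (use assms(21) that in simp)
  have step: "x (k + 1) \<omega> = l1_prox X (\<epsilon> / L) (x k \<omega>)
      (x k \<omega> - (1 / L) *\<^sub>R ((1 / m) *\<^sub>R (\<Sum>i=1..m. G (x k \<omega>) (Z k i \<omega>))))"
    if k: "k \<in> {1..K}" and \<omega>: "\<omega> \<in> space M" for k \<omega>
  proof -
    have "x k \<omega> \<in> X" using xX k \<omega> by simp
    with assms(39)[OF k \<omega>, unfolded assms(26)[OF k] assms(32)]
    have "x (k + 1) \<omega> = l1_prox X \<psi> (x k \<omega>) (x k \<omega> - (1 / L) *\<^sub>R g k \<omega>)"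
      by (rule l1_prox_eqI[OF assms(4,5) \<psi>])
    then show ?thesis
      unfolding assms(38)[OF k \<omega>] mk[OF k] assms(30) .
  qed
  have sources: "{Sample k i |k i. k \<in> {1..K} \<and> i \<in> {1..mk k}} = {Sample k i |k i. k \<in> {1..K} \<and> i \<in> {1..m}}"
    using mk by auto
  interpret l1_prox_method M \<Xi> X f "grad f" G \<zeta> Z x Y \<sigma> L flow \<epsilon> K m
  proof
    show "Z k i \<in> measurable M \<Xi> \<and> distr M \<Xi> (Z k i) = distr M \<Xi> \<zeta>"
      if "k \<in> {1..K}" "i \<in> {1..m}" for k i
      using assms(33)[of k i] mk that by simp
    show "prob {\<omega> \<in> space M. Y \<omega> = k} = 1 / K" if "k \<in> {1..K}" for k
      using assms(36)[OF that] assms(31)[OF that] by simp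
    show "GDERIV f y :> grad f y" for y
      by (rule GDERIV_grad) (rule assms(9))
    show "(expectation (\<lambda>\<omega>. f (x 1 \<omega>)) - flow) * L / \<epsilon>\<^sup>2 \<le> K"
      using K_bounds(1) by (simp add: assms(23))
  qed (fact assms Kpos mpos m_bounds(1) step assms(37)[unfolded sources])+
  have dst: "dist0_inf (frechet_subdiff (\<lambda>y. ereal (f y) + set_indicator X y) (x (Y \<omega> + 1) \<omega>)) =
      dst (x (Y \<omega> + 1) \<omega>)" if "\<omega> \<in> space M" for \<omega>
    using frechet_subdiff_add_indicator[OF assms(5) x_in D] Y(2)[OF that] that
    by (simp add: dst_def)
  have "(\<integral>\<^sup>+\<omega>. dist0_inf (frechet_subdiff (\<lambda>y. ereal (f y) + set_indicator X y) (x (Y \<omega> + 1) \<omega>)) \<partial>M)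
      \<le> ennreal (11 / 2 * \<epsilon>)"
    using nn_integral_dst_output by (simp only: dst cong: nn_integral_cong)
  also have "\<dots> \<le> ennreal (C1 * \<epsilon>)"
    using assms(25) by (intro ennreal_leI) (simp add: C1_def)
  finally have bound: "(\<integral>\<^sup>+\<omega>. dist0_inf (frechet_subdiff (\<lambda>y. ereal (f y) + set_indicator X y)
      (x (Y \<omega> + 1) \<omega>)) \<partial>M) \<le> ennreal (C1 * \<epsilon>)" .
  have meas: "(\<lambda>\<omega>. dist0_inf (frechet_subdiff (\<lambda>y. ereal (f y) + set_indicator X y) (x (Y \<omega> + 1) \<omega>)))
      \<in> borel_measurable M"
    using dst_output_rv by (subst measurable_cong[OF dst])
  have total: "(\<Sum>k=1..K. mk k) = K * m"
    using mk by simp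
  have "real (K * m) \<le> C2 * (\<Delta> * L * ln (real CARD('n)) * \<sigma>\<^sup>2 / \<epsilon> ^ 4)"
    if "1 \<le> \<Delta> * L / \<epsilon>\<^sup>2" "1 \<le> exp 1 ^ 2 * ln (real CARD('n)) * \<sigma>\<^sup>2 / \<epsilon>\<^sup>2"
  proof -
    have double: "b \<le> 2 * c" if "b \<le> c + 1" "1 \<le> c" for b c :: real
      using that by simp
    have "real K * real m \<le> (2 * (\<Delta> * L / \<epsilon>\<^sup>2)) * (2 * (exp 1 ^ 2 * ln (real CARD('n)) * \<sigma>\<^sup>2 / \<epsilon>\<^sup>2))"
    proof (intro mult_mono)
      show "K \<le> 2 * (\<Delta> * L / \<epsilon>\<^sup>2)" by (rule double[OF K_bounds(2) that(1)])
      show "m \<le> 2 * (exp 1 ^ 2 * ln (real CARD('n)) * \<sigma>\<^sup>2 / \<epsilon>\<^sup>2)"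
        by (rule double[OF m_bounds(2) that(2)])
    qed (use a in auto)
    also have "\<dots> = C2 * (\<Delta> * L * ln (real CARD('n)) * \<sigma>\<^sup>2 / \<epsilon> ^ 4)"
      using assms(25) by (simp add: C2_def field_simps flip: power_add)
    finally show ?thesis by simp
  qed
  with meas bound total show ?thesis by blast
qed

end
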